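(* For every permutation $(a,b,c)$ of $(2,1,0)$, each of the following four exact sequences is non-trivial: (i) $0\to\Delta_a(\ker\Delta_b\cap\ker\Delta_c)\to\langle\Delta_a,\Delta_b\rangle(\ker\Delta_c)\to\Delta_b(\ker\Delta_c)\to0$, with maps $x\mapsto(x,0)$ and $(x,y)\mapsto y$; (ii) $0\to\Delta_a(\ker\Delta_b\cap\ker\Delta_c)\to\langle\Delta_a,\Delta_b,\Delta_c\rangle(\mathcal C)\to\langle\Delta_b,\Delta_c\rangle(\mathcal C)\to0$, with maps $x\mapsto(x,0,0)$ and $(x,y,z)\mapsto(y,z)$; (iii) $0\to\langle\Delta_a,\Delta_b\rangle(\ker\Delta_c)\to\langle\Delta_a,\Delta_b,\Delta_c\rangle(\mathcal C)\to\Delta_c(\mathcal C)\to0$, with maps $(x,y)\mapsto(x,y,0)$ and $(x,y,z)\mapsto z$; (iv) $0\to\Delta_b(\ker\Delta_c)\to\langle\Delta_b,\Delta_c\rangle(\mathcal C)\to\Delta_c(\mathcal C)\to0$, with maps $y\mapsto(y,0)$ and $(y,z)\mapsto z$.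
   Context: All spaces are complex. For the couple $(X_0,X_1)=(\ell_\infty,\ell_1)$ put $\Sigma=\ell_\infty+\ell_1$. The Calderón space $\mathcal C$ of the couple is the Banach space of bounded continuous functions $F:\{z\in\mathbb C:0\le \mathrm{Re}\,z\le 1\}\to\Sigma$, analytic on the open strip, such that for $j=0,1$ the map $t\mapsto F(j+it)$ is continuous from $\mathbb R$ into $X_j$ and tends to $0$ as $|t|\to\infty$, with norm $\|F\|=\max_{j=0,1}\sup_{t}\|F(j+it)\|_{X_j}$. For $k=0,1,2$ let $\Delta_k:\mathcal C\to\Sigma$, $\Delta_k(F)=F^{(k)}(1/2)/k!$, and for distinct indices $\langle\Delta_a,\Delta_b\rangle(F)=(\Delta_aF,\Delta_bF)$, $\langle\Delta_a,\Delta_b,\Delta_c\rangle(F)=(\Delta_aF,\Delta_bF,\Delta_cF)$. For a closed subspace $K\subset\mathcal C$ and one of these maps $T$, the space $T(K)$ carries the quotient norm $\|x\|=\inf\{\|F\|:F\in K,\ TF=x\}$. An exact sequence $0\to Y\to Z\to X\to0$ of Banach spaces and bounded operators is trivial if the image of $Y$ is complemented in $Z$, and non-trivial otherwise. *)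

theory Defs
  imports "HOL-Analysis.Analysis"
begin

section \<open>Complex normed spaces\<close>

class complex_normed_vector = real_normed_vector +
  fixes scaleC :: "complex \<Rightarrow> 'a \<Rightarrow> 'a"  (infixr \<open>*\<^sub>C\<close> 75)
  assumes scaleC_add_right: "c *\<^sub>C (x + y) = c *\<^sub>C x + c *\<^sub>C y"
    and scaleC_add_left: "(c + d) *\<^sub>C x = c *\<^sub>C x + d *\<^sub>C x"
    and scaleC_scaleC: "c *\<^sub>C d *\<^sub>C x = (c * d) *\<^sub>C x"
    and scaleR_scaleC: "r *\<^sub>R x = complex_of_real r *\<^sub>C x"
    and norm_scaleC: "norm (c *\<^sub>C x) = cmod c * norm x"

instantiation complex :: complex_normed_vector
begin

definition scaleC_complex :: "complex \<Rightarrow> complex \<Rightarrow> complex"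
  where "scaleC_complex c x = c * x"

instance
  by standard (auto simp: scaleC_complex_def algebra_simps norm_mult scaleR_conv_of_real)

end

instantiation prod :: (complex_normed_vector, complex_normed_vector) complex_normed_vector
begin

definition scaleC_prod :: "complex \<Rightarrow> 'a \<times> 'b \<Rightarrow> 'a \<times> 'b"
  where "scaleC_prod c p = (c *\<^sub>C fst p, c *\<^sub>C snd p)"

instance
proof
  fix c :: complex and x :: "'a \<times> 'b"
  have "norm (c *\<^sub>C x) = sqrt ((cmod c)\<^sup>2 * ((norm (fst x))\<^sup>2 + (norm (snd x))\<^sup>2))"
    by (simp add: scaleC_prod_def norm_prod_def norm_scaleC power_mult_distrib algebra_simps)
  then show "norm (c *\<^sub>C x) = cmod c * norm x"
    by (simp add: norm_prod_def real_sqrt_mult)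
qed (auto simp: scaleC_prod_def scaleC_add_right scaleC_add_left scaleC_scaleC scaleR_scaleC
      scaleR_prod_def)

end

lemma scaleC_bcontfun_mem:
  fixes f :: "'a::topological_space \<Rightarrow>\<^sub>C 'b::complex_normed_vector"
  shows "(\<lambda>x. c *\<^sub>C f x) \<in> bcontfun"
proof (rule bcontfun_normI)
  have "bounded_linear (\<lambda>y::'b. c *\<^sub>C y)"
    by (rule bounded_linear_intro[where K = "cmod c"])
      (simp_all add: scaleC_add_right scaleR_scaleC scaleC_scaleC norm_scaleC mult.commute)
  then show "continuous_on UNIV (\<lambda>x. c *\<^sub>C f x)"
    by (rule bounded_linear.continuous_on) simp
  show "norm (c *\<^sub>C f x) \<le> cmod c * norm f" for x
    by (simp add: norm_scaleC norm_bounded mult_left_mono)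
qed

instantiation bcontfun :: (topological_space, complex_normed_vector) complex_normed_vector
begin

definition scaleC_bcontfun :: "complex \<Rightarrow> ('a \<Rightarrow>\<^sub>C 'b) \<Rightarrow> 'a \<Rightarrow>\<^sub>C 'b"
  where "scaleC_bcontfun c f = Bcontfun (\<lambda>x. c *\<^sub>C f x)"

lemma apply_scaleC_bcontfun [simp]: "apply_bcontfun (c *\<^sub>C f) x = c *\<^sub>C apply_bcontfun f x"
  by (simp add: scaleC_bcontfun_def Bcontfun_inverse scaleC_bcontfun_mem)

instance
proof
  fix c d :: complex and r :: real and f g :: "'a \<Rightarrow>\<^sub>C 'b"
  show "c *\<^sub>C (f + g) = c *\<^sub>C f + c *\<^sub>C g" "(c + d) *\<^sub>C f = c *\<^sub>C f + d *\<^sub>C f"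
    and ss: "c *\<^sub>C d *\<^sub>C f = (c * d) *\<^sub>C f" and rc: "r *\<^sub>R f = complex_of_real r *\<^sub>C f" for c d r and f :: "'a \<Rightarrow>\<^sub>C 'b"
    by (auto intro!: bcontfun_eqI simp: scaleC_add_right scaleC_add_left scaleC_scaleC scaleR_scaleC)
  have le: "norm (c *\<^sub>C f) \<le> cmod c * norm f" for c and f :: "'a \<Rightarrow>\<^sub>C 'b"
    by (rule norm_bound) (simp add: norm_scaleC norm_bounded mult_left_mono)
  show "norm (c *\<^sub>C f) = cmod c * norm f"
  proof (cases "c = 0")
    case True
    with le[of c f] show ?thesis by simp
  next
    case False
    have "f = inverse c *\<^sub>C c *\<^sub>C f"
      using False rc[of 1 f] by (simp add: ss)
    then have "norm f \<le> inverse (cmod c) * norm (c *\<^sub>C f)"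
      using le[of "inverse c" "c *\<^sub>C f"] by (simp add: norm_inverse)
    then have "cmod c * norm f \<le> norm (c *\<^sub>C f)"
      using False by (simp add: field_simps)
    with le[of c f] show ?thesis by simp
  qed
qed

end


section \<open>Normed spaces on a subset of a type\<close>

text \<open>The spaces below live on subsets of a type and carry norms that differ from the norm
  of that type.\<close>

record 'a nspace =
  pts :: "'a set"
  nrm :: "'a \<Rightarrow> real"

definition bounded_op ::
    "'a::complex_normed_vector nspace \<Rightarrow> 'b::complex_normed_vector nspace \<Rightarrow> ('a \<Rightarrow> 'b) \<Rightarrow> bool"
  where "bounded_op X Y f \<longleftrightarrow>
    f ` pts X \<subseteq> pts Y \<and>
    (\<forall>x\<in>pts X. \<forall>y\<in>pts X. f (x + y) = f x + f y) \<and>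
    (\<forall>c. \<forall>x\<in>pts X. f (c *\<^sub>C x) = c *\<^sub>C f x) \<and>
    (\<exists>B. \<forall>x\<in>pts X. nrm Y (f x) \<le> B * nrm X x)"

definition complemented :: "'a::complex_normed_vector nspace \<Rightarrow> 'a set \<Rightarrow> bool"
  where "complemented Z W \<longleftrightarrow>
    (\<exists>P. bounded_op Z Z P \<and> P ` pts Z = W \<and> (\<forall>w\<in>W. P w = w))"

definition exact_sequence ::
    "'a::complex_normed_vector nspace \<Rightarrow> ('a \<Rightarrow> 'b) \<Rightarrow> 'b::complex_normed_vector nspace \<Rightarrow>
     ('b \<Rightarrow> 'c) \<Rightarrow> 'c::complex_normed_vector nspace \<Rightarrow> bool"
  where "exact_sequence Y i Z q X \<longleftrightarrow>
    bounded_op Y Z i \<and> bounded_op Z X q \<and>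
    inj_on i (pts Y) \<and> i ` pts Y = {z \<in> pts Z. q z = 0} \<and> q ` pts Z = pts X"

definition nontrivial_exact_sequence ::
    "'a::complex_normed_vector nspace \<Rightarrow> ('a \<Rightarrow> 'b) \<Rightarrow> 'b::complex_normed_vector nspace \<Rightarrow>
     ('b \<Rightarrow> 'c) \<Rightarrow> 'c::complex_normed_vector nspace \<Rightarrow> bool"
  where "nontrivial_exact_sequence Y i Z q X \<longleftrightarrow>
    exact_sequence Y i Z q X \<and> \<not> complemented Z (i ` pts Y)"


section \<open>The couple of bounded and of absolutely summable sequences\<close>

text \<open>Every function on the discrete space \<^typ>\<open>nat\<close> is continuous, so this type consists of
  all bounded complex sequences, with the supremum norm.\<close>

type_synonym linf = "nat \<Rightarrow>\<^sub>C complex"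

definition linf_space :: "linf nspace"
  where "linf_space = \<lparr>pts = UNIV, nrm = norm\<rparr>"

definition l1_space :: "linf nspace"
  where "l1_space = \<lparr>pts = {x :: linf. summable (\<lambda>n. cmod (x n))}, nrm = (\<lambda>x :: linf. \<Sum>n. cmod (x n))\<rparr>"

definition couple :: "nat \<Rightarrow> linf nspace"
  where "couple j = (if j = 0 then linf_space else l1_space)"

definition sum_space :: "'a::real_normed_vector nspace \<Rightarrow> 'a nspace \<Rightarrow> 'a nspace"
  where "sum_space X Y =
    \<lparr>pts = {x + y | x y. x \<in> pts X \<and> y \<in> pts Y},
     nrm = (\<lambda>s. Inf {nrm X x + nrm Y y | x y. x \<in> pts X \<and> y \<in> pts Y \<and> s = x + y})\<rparr>"

text \<open>The sum space of the couple is the whole type \<^typ>\<open>linf\<close> with its own norm. This is why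
  continuity, boundedness and derivatives with values in the sum space can be expressed by the
  corresponding notions for that type.\<close>

lemma norm_le_l1:
  fixes x :: linf
  assumes "summable (\<lambda>n. cmod (x n))"
  shows "norm x \<le> (\<Sum>n. cmod (x n))"
proof (rule norm_bound)
  fix n
  show "cmod (x n) \<le> (\<Sum>n. cmod (x n))"
    using sum_le_suminf[OF assms, of "{n}"] by simp
qed

lemma sum_space_couple: "sum_space (couple 0) (couple 1) = \<lparr>pts = UNIV, nrm = norm\<rparr>"
proof -
  define A :: "linf \<Rightarrow> real set" where
    "A s = {norm x + (\<Sum>n. cmod (apply_bcontfun y n)) | x y. summable (\<lambda>n. cmod (apply_bcontfun y n)) \<and> s = x + y}" for s
  have "Inf (A s) = norm s" for s
  proof (rule cInf_eq_minimum)
    show "norm s \<in> A s"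
      unfolding A_def by (rule CollectI, rule exI[of _ s], rule exI[of _ 0]) simp
    fix r assume "r \<in> A s"
    then obtain x y where r: "r = norm x + (\<Sum>n. cmod (apply_bcontfun y n))"
      and y: "summable (\<lambda>n. cmod (apply_bcontfun y n))" and s: "s = x + y"
      unfolding A_def by blast
    show "norm s \<le> r"
      unfolding r s using norm_triangle_ineq[of x y] norm_le_l1[OF y] by linarith
  qed
  moreover have "{x + y | x y. summable (\<lambda>n. cmod (apply_bcontfun y n))} = UNIV"
  proof -
    have "\<exists>x y :: linf. s = x + y \<and> summable (\<lambda>n. cmod (apply_bcontfun y n))" for s
      by (rule exI[of _ s], rule exI[of _ 0]) simp
    then show ?thesis by blast
  qed
  ultimately show ?thesis
    by (simp add: sum_space_def couple_def linf_space_def l1_space_def A_def)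
qed


section \<open>The Calderon space\<close>

definition has_cderiv :: "(complex \<Rightarrow> 'a::complex_normed_vector) \<Rightarrow> 'a \<Rightarrow> complex \<Rightarrow> bool"
  where "has_cderiv F D z \<longleftrightarrow> (F has_derivative (\<lambda>h. h *\<^sub>C D)) (at z)"

definition cderiv :: "(complex \<Rightarrow> 'a::complex_normed_vector) \<Rightarrow> complex \<Rightarrow> 'a"
  where "cderiv F z = (THE D. has_cderiv F D z)"

definition strip :: "complex set"
  where "strip = {z. 0 \<le> Re z \<and> Re z \<le> 1}"

definition open_strip :: "complex set"
  where "open_strip = {z. 0 < Re z \<and> Re z < 1}"

definition edge :: "nat \<Rightarrow> (complex \<Rightarrow> 'a) \<Rightarrow> real \<Rightarrow> 'a"
  where "edge j F t = F (of_nat j + \<i> * of_real t)"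

definition continuous_into :: "'a::real_normed_vector nspace \<Rightarrow> (real \<Rightarrow> 'a) \<Rightarrow> bool"
  where "continuous_into X f \<longleftrightarrow>
    range f \<subseteq> pts X \<and> (\<forall>t. ((\<lambda>s. nrm X (f s - f t)) \<longlongrightarrow> 0) (at t))"

text \<open>The elements of the Calderon space are functions on the closed strip; they are
  represented by functions on the plane that vanish outside it.\<close>

definition calderon :: "(complex \<Rightarrow> linf) set"
  where "calderon = {F.
    (\<forall>z. z \<notin> strip \<longrightarrow> F z = 0) \<and>
    continuous_on strip F \<and> bounded (F ` strip) \<and>
    (\<forall>z\<in>open_strip. \<exists>D. has_cderiv F D z) \<and>
    (\<forall>j\<in>{0, 1}. continuous_into (couple j) (edge j F) \<and>
      ((\<lambda>t. nrm (couple j) (edge j F t)) \<longlongrightarrow> 0) at_infinity)}"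

definition calderon_norm :: "(complex \<Rightarrow> linf) \<Rightarrow> real"
  where "calderon_norm F = (MAX j\<in>{0, 1}. SUP t. nrm (couple j) (edge j F t))"

definition delta :: "nat \<Rightarrow> (complex \<Rightarrow> linf) \<Rightarrow> linf"
  where "delta k F = (cderiv ^^ k) F (1 / 2) /\<^sub>R fact k"

definition delta2 :: "nat \<Rightarrow> nat \<Rightarrow> (complex \<Rightarrow> linf) \<Rightarrow> linf \<times> linf"
  where "delta2 a b F = (delta a F, delta b F)"

definition delta3 :: "nat \<Rightarrow> nat \<Rightarrow> nat \<Rightarrow> (complex \<Rightarrow> linf) \<Rightarrow> linf \<times> linf \<times> linf"
  where "delta3 a b c F = (delta a F, delta b F, delta c F)"

definition ker_delta :: "nat \<Rightarrow> (complex \<Rightarrow> linf) set"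
  where "ker_delta k = {F \<in> calderon. delta k F = 0}"

definition quotient_space :: "((complex \<Rightarrow> linf) \<Rightarrow> 'a) \<Rightarrow> (complex \<Rightarrow> linf) set \<Rightarrow> 'a nspace"
  where "quotient_space T K =
    \<lparr>pts = T ` K, nrm = (\<lambda>x. INF F\<in>{F \<in> K. T F = x}. calderon_norm F)\<rparr>"

end

theory Submission
  imports Defs "HOL-Complex_Analysis.Complex_Analysis" "HOL-Real_Asymp.Real_Asymp"
begin

text \<open>A bounded projection onto the image of the first space gives a bounded linear section of the
  quotient map. Sequence (ii) restricts to (i) and sequence (iii) induces (iv), so the section
  yields in all cases a bounded linear way to prescribe one more Taylor coefficient of a function
  in the Calderon space, either given one coefficient or given one coefficient and the vanishing of
  another one. Test it on \<open>h(z) \<epsilon>\<close>, where \<open>\<epsilon>\<close> runs through the characters of a cyclic group of order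
  \<open>k\<close> acting on a block of \<open>k\<close> coordinates. Averaging over the characters and over the block leaves
  scalar functions on the strip, bounded by \<open>N\<close> on the left and by \<open>N / k\<close> on the right edge, that is,
  \<open>k powr -z\<close> times bounded functions; the prescribed coefficient becomes the average \<open>\<lambda>\<close> of the
  diagonal of the section over the block. Comparing Taylor coefficients at \<open>1/2\<close> forces
  \<open>\<lambda> = \<kappa> (ln k) powr e + O((ln k) powr (e - 1))\<close> with \<open>\<kappa> \<noteq> 0\<close> and \<open>e \<in> {-2, -1, 1, 2}\<close>. A block of
  length \<open>k\<^sup>2\<close> consists of \<open>k\<close> blocks of length \<open>k\<close>, so its average satisfies this with \<open>ln k\<close> as well as
  with \<open>2 ln k\<close>, a contradiction for large \<open>k\<close>.\<close>

section \<open>Coordinatewise holomorphic functions\<close>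

lemma scaleC_one [simp]: "1 *\<^sub>C x = x"
  using scaleR_scaleC[of 1 x] by simp

lemma scaleC_zero_left [simp]: "0 *\<^sub>C x = 0"
  using scaleR_scaleC[of 0 x] by simp

lemma scaleC_zero_right [simp]: "c *\<^sub>C 0 = 0"
  using scaleC_add_right[of c 0 0] by simp

lemma scaleC_minus_one: "(-1) *\<^sub>C x = - x"
  using scaleR_scaleC[of "-1" x] by simp

lemma bounded_linear_scaleC_left: "bounded_linear (\<lambda>c. c *\<^sub>C x)"
  by (rule bounded_linear_intro[where K = "norm x"])
    (simp_all add: scaleC_add_left scaleR_scaleC scaleC_scaleC scaleC_complex_def norm_scaleC)

lemma bounded_linear_scaleC_right: "bounded_linear (\<lambda>x. c *\<^sub>C x)"
  by (rule bounded_linear_intro[where K = "cmod c"])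
    (simp_all add: scaleC_add_right scaleR_scaleC scaleC_scaleC norm_scaleC mult.commute)

declare scaleC_complex_def [simp]

lemma apply_sum_bcontfun: "apply_bcontfun (\<Sum>i\<in>A. f i) n = (\<Sum>i\<in>A. apply_bcontfun (f i) n)"
  by (induction A rule: infinite_finite_induct) simp_all

lemma bounded_linear_apply_bcontfun: "bounded_linear (\<lambda>x. apply_bcontfun x n)"
  by (rule bounded_linear_intro[where K = 1]) (simp_all add: norm_bounded)

lemma apply_Bcontfun_linf:
  assumes "\<And>n. cmod (x n) \<le> M"
  shows "apply_bcontfun (Bcontfun x :: linf) = x"
  by (rule Bcontfun_inverse, rule bcontfun_normI[OF _ assms]) simp

lemma has_cderiv_unique:
  assumes "has_cderiv F D z" "has_cderiv F D' z"
  shows "D = D'"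
  using has_derivative_unique[of F "\<lambda>h. h *\<^sub>C D" z "\<lambda>h. h *\<^sub>C D'"] assms
  unfolding has_cderiv_def by (metis scaleC_one)

lemma cderiv_eqI: "has_cderiv F D z \<Longrightarrow> cderiv F z = D"
  unfolding cderiv_def by (rule the_equality) (auto dest: has_cderiv_unique)

lemma has_cderiv_coordinate:
  fixes F :: "complex \<Rightarrow> linf"
  assumes "has_cderiv F D z"
  shows "((\<lambda>w. F w n) has_field_derivative D n) (at z)"
  using bounded_linear.has_derivative[OF bounded_linear_apply_bcontfun assms[unfolded has_cderiv_def], of n]
  by (simp add: has_field_derivative_def mult_commute_abs)

text \<open>The local bound is on the supremum norm and hence uniform in the coordinate, which
  allows scalar Cauchy estimates to be used in all coordinates at once.\<close>

definition coord_holomorphic :: "(complex \<Rightarrow> linf) \<Rightarrow> complex set \<Rightarrow> bool"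
  where "coord_holomorphic F U \<longleftrightarrow> (\<forall>n. (\<lambda>z. F z n) holomorphic_on U) \<and>
    (\<forall>z\<in>U. \<exists>r>0. \<exists>M. cball z r \<subseteq> U \<and> (\<forall>w\<in>cball z r. norm (F w) \<le> M))"

text \<open>Cauchy's inequalities bound the Taylor remainders of all coordinates simultaneously, so that
  coordinatewise differentiability becomes differentiability in the supremum norm.\<close>

lemma coord_holomorphic_has_cderiv:
  assumes F: "coord_holomorphic F U" and z: "z \<in> U"
  shows "\<exists>D. has_cderiv F D z \<and> (\<forall>n. apply_bcontfun D n = deriv (\<lambda>w. F w n) z)" (is ?deriv)
    and "\<exists>r>0. \<exists>M. cball z r \<subseteq> U \<and> (\<forall>w\<in>cball z r. \<forall>n. cmod (deriv (\<lambda>w. F w n) w) \<le> M)" (is ?bdd)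
proof -
  have hol: "(\<lambda>z. F z n) holomorphic_on U" for n
    using F unfolding coord_holomorphic_def by blast
  obtain r M where r: "r > 0" "cball z r \<subseteq> U" and M: "\<And>w. w \<in> cball z r \<Longrightarrow> norm (F w) \<le> M"
    using F z unfolding coord_holomorphic_def by meson
  have M': "cmod (F w n) \<le> M" if "w \<in> cball z r" for w n
    using M[OF that] norm_bounded[of "F w" n] by linarith
  \<comment> \<open>Half the radius leaves around every point of \<open>cball z s\<close> a disc of
    radius \<open>s\<close> on which \<open>M\<close> bounds all coordinates.\<close>
  define s where "s = r / 2"
  have s: "s > 0" "cball z s \<subseteq> U" using r by (auto simp: s_def)
  have sub: "cball w s \<subseteq> cball z r" if "w \<in> cball z s" for w
  proof
    fix v assume "v \<in> cball w s"
    then show "v \<in> cball z r"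
      using that dist_triangle[of z v w] by (simp add: s_def)
  qed
  have cauchy: "cmod ((deriv ^^ k) (\<lambda>w. F w n) w) \<le> fact k * M / s ^ k" if "w \<in> cball z s" for w n k
  proof (rule Cauchy_inequality)
    have "cball w s \<subseteq> U" using sub[OF that] r by blast
    then show "(\<lambda>w. F w n) holomorphic_on ball w s" "continuous_on (cball w s) (\<lambda>w. F w n)"
      using hol[of n] by (meson holomorphic_on_subset ball_subset_cball order_trans,
        meson holomorphic_on_imp_continuous_on holomorphic_on_subset)
    show "cmod (F x n) \<le> M" if "cmod (w - x) = s" for x
      using that sub[OF \<open>w \<in> cball z s\<close>] by (intro M') (auto simp: dist_norm)
  qed (use s in auto)
  define D :: linf where "D = Bcontfun (\<lambda>n. deriv (\<lambda>w. F w n) z)"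
  have D: "apply_bcontfun D n = deriv (\<lambda>w. F w n) z" for n
    unfolding D_def using cauchy[of z 1] s by (subst apply_Bcontfun_linf[where M = "M / s"]) auto
  have holball: "(\<lambda>w. F w n) holomorphic_on ball z r" for n
    using hol[of n] r by (meson holomorphic_on_subset ball_subset_cball order_trans)
  have taylor: "cmod (F w n - F z n - (w - z) * D n) \<le> 2 * M / s ^ 2 * (cmod (w - z))\<^sup>2"
    if w: "w \<in> cball z s" for w n
  proof -
    have "cmod ((deriv ^^ 0) (\<lambda>w. F w n) w
        - (\<Sum>i\<le>1. (deriv ^^ i) (\<lambda>w. F w n) z * (w - z) ^ i / fact i))
      \<le> (2 * M / s ^ 2) * cmod (w - z) ^ Suc 1 / fact 1"
    proof (rule complex_Taylor[where S = "cball z s"])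
      fix i x assume x: "x \<in> cball z s"
      have "x \<in> ball z r" using x r by (auto simp: s_def)
      then have "((deriv ^^ i) (\<lambda>w. F w n) has_field_derivative deriv ((deriv ^^ i) (\<lambda>w. F w n)) x) (at x)"
        by (intro has_field_derivative_higher_deriv[THEN DERIV_chain2[where g = "\<lambda>x. x", OF _ DERIV_ident], simplified])
          (use holball in auto)
      then show "((deriv ^^ i) (\<lambda>w. F w n) has_field_derivative (deriv ^^ Suc i) (\<lambda>w. F w n) x) (at x within cball z s)"
        by (simp add: has_field_derivative_at_within)
    next
      fix x assume "x \<in> cball z s"
      then show "cmod ((deriv ^^ Suc 1) (\<lambda>w. F w n) x) \<le> 2 * M / s ^ 2"
        using cauchy[of x 2 n] by (simp add: numeral_2_eq_2)
    qed (use w s in auto)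
    then show ?thesis
      by (simp add: D algebra_simps power2_eq_square)
  qed
  define C where "C = 2 * M / s ^ 2"
  have taylor: "norm (F w - F z - (w - z) *\<^sub>C D) \<le> C * (cmod (w - z))\<^sup>2" if "w \<in> cball z s" for w
    using taylor[OF that] unfolding C_def by (intro norm_bound) simp
  have "has_cderiv F D z"
    unfolding has_cderiv_def has_derivative_def
  proof (intro conjI bounded_linear_scaleC_left)
    let ?q = "\<lambda>w. (F w - F z - (w - z) *\<^sub>C D) /\<^sub>R norm (w - z)"
    have "(?q \<longlongrightarrow> 0) (at z)"
    proof (rule Lim_null_comparison)
      show "\<forall>\<^sub>F w in at z. norm (?q w) \<le> C * cmod (w - z)"
        unfolding eventually_at
      proof (intro exI conjI ballI impI)
        fix w assume w: "w \<noteq> z \<and> dist w z < s"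
        then have "norm (F w - F z - (w - z) *\<^sub>C D) \<le> C * (cmod (w - z))\<^sup>2"
          by (intro taylor) (auto simp: dist_commute)
        with w show "norm (?q w) \<le> C * cmod (w - z)"
          by (simp add: divide_simps power2_eq_square)
      qed (rule s)
      show "((\<lambda>w. C * cmod (w - z)) \<longlongrightarrow> 0) (at z)"
        by (auto intro!: tendsto_eq_intros)
    qed
    \<comment> \<open>The unfolded definition names the base point as the limit of the identity
      along \<open>at z\<close>, which is \<open>z\<close>.\<close>
    then show "((\<lambda>w. (F w - F (Lim (at z) (\<lambda>x. x)) - (w - Lim (at z) (\<lambda>x. x)) *\<^sub>C D) /\<^sub>R norm (w - Lim (at z) (\<lambda>x. x))) \<longlongrightarrow> 0) (at z)"
      by (simp add: Lim_ident_at)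
  qed
  with D show ?deriv by blast
  show ?bdd
    using s cauchy[of _ 1] by (intro exI[of _ s] conjI exI[of _ "M / s"]) auto
qed

lemma cderiv_coordinate:
  assumes "coord_holomorphic F U" "z \<in> U"
  shows "apply_bcontfun (cderiv F z) n = deriv (\<lambda>w. F w n) z"
  using coord_holomorphic_has_cderiv(1)[OF assms] cderiv_eqI by blast

text \<open>Allows \<open>cderiv\<close> to be iterated: the Cauchy bounds on the first derivatives
  of the coordinates serve as the local bound for \<open>cderiv F\<close>.\<close>

lemma coord_holomorphic_cderiv:
  assumes F: "coord_holomorphic F U" and U: "open U"
  shows "coord_holomorphic (cderiv F) U"
  unfolding coord_holomorphic_def
proof (intro conjI allI ballI)
  fix n
  have "(\<lambda>z. F z n) holomorphic_on U"
    using F unfolding coord_holomorphic_def by blast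
  from holomorphic_deriv[OF this U]
  show "(\<lambda>z. apply_bcontfun (cderiv F z) n) holomorphic_on U"
    by (rule holomorphic_transform) (simp add: cderiv_coordinate[OF F])
next
  fix z assume z: "z \<in> U"
  obtain r M where "r > 0" "cball z r \<subseteq> U"
    and M: "\<And>w n. w \<in> cball z r \<Longrightarrow> cmod (deriv (\<lambda>w. F w n) w) \<le> M"
    using coord_holomorphic_has_cderiv(2)[OF F z] by blast
  moreover have "norm (cderiv F w) \<le> M" if "w \<in> cball z r" for w
    using M[OF that] \<open>cball z r \<subseteq> U\<close> that
    by (intro norm_bound) (auto simp: cderiv_coordinate[OF F])
  ultimately show "\<exists>r>0. \<exists>M. cball z r \<subseteq> U \<and> (\<forall>w\<in>cball z r. norm (cderiv F w) \<le> M)"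
    by blast
qed

text \<open>Agreement of the coordinates holds on the whole open set, so it survives
  differentiation. This turns the vector-valued derivatives in \<open>delta\<close> into scalar
  ones.\<close>

lemma higher_cderiv_coordinate:
  assumes "coord_holomorphic F U" "open U" "z \<in> U"
  shows "apply_bcontfun ((cderiv ^^ k) F z) n = (deriv ^^ k) (\<lambda>w. F w n) z"
  using assms(3)
proof (induction k arbitrary: z)
  case (Suc k)
  have hol: "coord_holomorphic ((cderiv ^^ k) F) U" for k
    by (induction k) (simp_all add: assms coord_holomorphic_cderiv)
  have "apply_bcontfun ((cderiv ^^ Suc k) F z) n = deriv (\<lambda>w. (cderiv ^^ k) F w n) z"
    using cderiv_coordinate[OF hol Suc.prems] by simp
  also have "\<dots> = deriv ((deriv ^^ k) (\<lambda>w. F w n)) z"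
    using eventually_nhds_in_open[OF assms(2) Suc.prems]
    by (intro deriv_cong_ev refl) (auto elim!: eventually_mono simp: Suc.IH)
  finally show ?case by simp
qed simp

section \<open>The maximum principle on the strip\<close>

lemma open_open_strip: "open open_strip"
proof -
  have "open_strip = {z. 0 < Re z} \<inter> {z. Re z < 1}" by (auto simp: open_strip_def)
  show ?thesis unfolding \<open>open_strip = _\<close> by (simp add: open_Int open_halfspace_Re_gt open_halfspace_Re_lt)
qed

lemma open_strip_subset: "open_strip \<subseteq> strip"
  by (auto simp: open_strip_def strip_def)

text \<open>A Phragmen-Lindelof argument: after multiplication by
  \<open>exp (\<delta> * (z^2 - 1))\<close>, whose modulus is at most 1 on the strip and decays
  vertically, the maximum modulus principle applies on a large rectangle; then \<delta> tends to
  0.\<close>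

lemma maximum_principle_strip:
  fixes g :: "complex \<Rightarrow> complex"
  assumes cont: "continuous_on strip g" and hol: "g holomorphic_on open_strip"
    and bdd: "\<And>z. z \<in> strip \<Longrightarrow> cmod (g z) \<le> M"
    and le0: "\<And>z. Re z = 0 \<Longrightarrow> cmod (g z) \<le> N" and le1: "\<And>z. Re z = 1 \<Longrightarrow> cmod (g z) \<le> N"
    and N: "N > 0" and \<xi>: "\<xi> \<in> strip"
  shows "cmod (g \<xi>) \<le> N"
proof -
  have damped: "cmod (g \<xi> * exp (of_real \<delta> * (\<xi>\<^sup>2 - 1))) \<le> N" if \<delta>: "\<delta> > 0" for \<delta>
  proof -
    let ?h = "\<lambda>z. g z * exp (of_real \<delta> * (z\<^sup>2 - 1))"
    have "(\<lambda>R. M * exp (- \<delta> * R\<^sup>2)) \<longlonglongrightarrow> 0" using \<delta> by real_asymp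
    then have "\<forall>\<^sub>F R in sequentially. M * exp (- \<delta> * (real R)\<^sup>2) < N"
      using N by (simp add: order_tendstoD)
    moreover have "\<forall>\<^sub>F R in sequentially. \<bar>Im \<xi>\<bar> < real R" by real_asymp
    ultimately have "\<forall>\<^sub>F R in sequentially. M * exp (- \<delta> * (real R)\<^sup>2) < N \<and> \<bar>Im \<xi>\<bar> < real R"
      by (rule eventually_conj)
    \<comment> \<open>On the horizontal sides of the rectangle the damping has to beat the a priori
      bound \<open>M\<close>, and \<xi> has to lie between them.\<close>
    then obtain R where R: "M * exp (- \<delta> * R\<^sup>2) < N" "\<bar>Im \<xi>\<bar> < R"
      by (auto simp: eventually_sequentially)
    define S where "S = cbox (Complex 0 (-R)) (Complex 1 R)"
    have norm_h: "cmod (?h z) = cmod (g z) * exp (\<delta> * ((Re z)\<^sup>2 - (Im z)\<^sup>2 - 1))" for z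
      by (simp add: norm_mult power2_eq_square)
    have S: "z \<in> S \<longleftrightarrow> 0 \<le> Re z \<and> Re z \<le> 1 \<and> - R \<le> Im z \<and> Im z \<le> R" for z
      by (auto simp: S_def in_cbox_complex_iff)
    have Sstrip: "S \<subseteq> strip" by (auto simp: S strip_def)
    have intS: "interior S \<subseteq> open_strip"
      by (auto simp: S_def interior_cbox in_box_complex_iff open_strip_def)
    show ?thesis
    proof (rule maximum_modulus_frontier[where S = S and f = ?h and \<xi> = \<xi>])
      show "?h holomorphic_on interior S"
        using holomorphic_on_subset[OF hol intS] by (intro holomorphic_intros)
      show "continuous_on (closure S) ?h"
        using continuous_on_subset[OF cont Sstrip] by (auto simp: S_def intro!: continuous_intros)
      show "bounded S" by (simp add: S_def)
      show "\<xi> \<in> S" using \<xi> R by (auto simp: S strip_def)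
      fix z assume "z \<in> frontier S"
      then have z: "z \<in> S" and "z \<notin> box (Complex 0 (-R)) (Complex 1 R)"
        by (auto simp: S_def frontier_def interior_cbox)
      then consider "Re z = 0" | "Re z = 1" | "\<bar>Im z\<bar> = R"
        unfolding S in_box_complex_iff by force
      then show "cmod (?h z) \<le> N"
      proof cases
        case 3
        have "\<delta> * ((Re z)\<^sup>2 - (Im z)\<^sup>2 - 1) \<le> - \<delta> * R\<^sup>2"
          using z \<delta> 3 power_le_one[of "Re z" 2] unfolding S
          by (auto simp: power2_eq_square[symmetric] power2_abs[of "Im z", symmetric]
              algebra_simps simp del: power2_abs)
        then have "cmod (g z) * exp (\<delta> * ((Re z)\<^sup>2 - (Im z)\<^sup>2 - 1)) \<le> M * exp (- \<delta> * R\<^sup>2)"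
          using bdd z Sstrip by (intro mult_mono) (auto intro: order_trans[OF norm_ge_zero])
        then show ?thesis unfolding norm_h using R by linarith
      next
        case 1
        have "exp (\<delta> * ((Re z)\<^sup>2 - (Im z)\<^sup>2 - 1)) \<le> 1" using 1 \<delta> order_trans[OF _ zero_le_power2[of "Im z"], of "- 1"] by (simp add: mult_le_0_iff)
        then have "cmod (?h z) \<le> N * 1" unfolding norm_h using le0[OF 1] N by (intro mult_mono) auto
        then show ?thesis by simp
      next
        case 2
        have "exp (\<delta> * ((Re z)\<^sup>2 - (Im z)\<^sup>2 - 1)) \<le> 1" using 2 \<delta> by (simp add: mult_le_0_iff)
        then have "cmod (?h z) \<le> N * 1" unfolding norm_h using le1[OF 2] N by (intro mult_mono) auto
        then show ?thesis by simp
      qed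
    qed
  qed
  have "((\<lambda>\<delta>. cmod (g \<xi> * exp (of_real \<delta> * (\<xi>\<^sup>2 - 1)))) \<longlongrightarrow> cmod (g \<xi> * exp (of_real 0 * (\<xi>\<^sup>2 - 1)))) (at_right 0)"
    by (intro tendsto_intros)
  moreover have "\<forall>\<^sub>F \<delta> in at_right 0. cmod (g \<xi> * exp (of_real \<delta> * (\<xi>\<^sup>2 - 1))) \<le> N"
    using damped by (auto simp: eventually_at_right_field intro: exI[of _ 1])
  ultimately show ?thesis
    using tendsto_upperbound[of _ _ "at_right (0::real)" N] by simp
qed

section \<open>The Calderon space as a vector space\<close>

lemma
  assumes "x \<in> pts (couple j)" "y \<in> pts (couple j)"
  shows couple_add: "x + y \<in> pts (couple j)"
    and nrm_couple_triangle: "nrm (couple j) (x + y) \<le> nrm (couple j) x + nrm (couple j) y"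
proof -
  have "summable (\<lambda>n. cmod (apply_bcontfun x n + apply_bcontfun y n))" and
    "(\<Sum>n. cmod (apply_bcontfun x n + apply_bcontfun y n)) \<le> (\<Sum>n. cmod (apply_bcontfun x n)) + (\<Sum>n. cmod (apply_bcontfun y n))"
    if "summable (\<lambda>n. cmod (apply_bcontfun x n))" "summable (\<lambda>n. cmod (apply_bcontfun y n))"
  proof -
    show s: "summable (\<lambda>n. cmod (apply_bcontfun x n + apply_bcontfun y n))"
      by (rule summable_comparison_test'[OF summable_add[OF that]]) (simp add: norm_triangle_ineq)
    show "(\<Sum>n. cmod (apply_bcontfun x n + apply_bcontfun y n)) \<le> (\<Sum>n. cmod (apply_bcontfun x n)) + (\<Sum>n. cmod (apply_bcontfun y n))"
      unfolding suminf_add[OF that] by (rule suminf_le[OF _ s summable_add[OF that]]) (simp add: norm_triangle_ineq)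
  qed
  then show "x + y \<in> pts (couple j)" "nrm (couple j) (x + y) \<le> nrm (couple j) x + nrm (couple j) y"
    using assms by (auto simp: couple_def linf_space_def l1_space_def norm_triangle_ineq)
qed

lemma
  assumes "x \<in> pts (couple j)"
  shows couple_scaleC: "c *\<^sub>C x \<in> pts (couple j)"
    and nrm_couple_scaleC: "nrm (couple j) (c *\<^sub>C x) = cmod c * nrm (couple j) x"
  using assms
  by (auto simp: couple_def linf_space_def l1_space_def norm_mult norm_scaleC suminf_mult summable_mult)

lemma nrm_couple_nonneg: "x \<in> pts (couple j) \<Longrightarrow> 0 \<le> nrm (couple j) x"
  by (auto simp: couple_def linf_space_def l1_space_def intro: suminf_nonneg)

lemma
  assumes "x \<in> pts (couple j)" "y \<in> pts (couple j)"
  shows couple_diff: "x - y \<in> pts (couple j)"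
    and nrm_couple_reverse: "\<bar>nrm (couple j) x - nrm (couple j) y\<bar> \<le> nrm (couple j) (x - y)"
proof -
  have minus: "- v \<in> pts (couple j)" "nrm (couple j) (- v) = nrm (couple j) v"
    if "v \<in> pts (couple j)" for v
    using couple_scaleC[OF that, of "-1"] nrm_couple_scaleC[OF that, of "-1"]
    by (simp_all add: scaleC_minus_one)
  show d: "x - y \<in> pts (couple j)"
    using couple_add[OF assms(1) minus(1)[OF assms(2)]] by simp
  show "\<bar>nrm (couple j) x - nrm (couple j) y\<bar> \<le> nrm (couple j) (x - y)"
    using nrm_couple_triangle[OF d assms(2)] nrm_couple_triangle[OF minus(1)[OF d] assms(1)]
      minus(2)[OF d] by simp
qed

lemma
  assumes "x \<in> pts (couple j)" "y \<in> pts (couple j)"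
  shows couple_lin: "x + c *\<^sub>C y \<in> pts (couple j)"
    and nrm_couple_lin: "nrm (couple j) (x + c *\<^sub>C y) \<le> nrm (couple j) x + cmod c * nrm (couple j) y"
  using couple_add[OF assms(1) couple_scaleC[OF assms(2)]]
    nrm_couple_triangle[OF assms(1) couple_scaleC[OF assms(2)], of c] nrm_couple_scaleC[OF assms(2), of c]
  by simp_all

lemma calderonD:
  assumes "F \<in> calderon"
  shows "z \<notin> strip \<Longrightarrow> F z = 0" "continuous_on strip F" "bounded (F ` strip)"
    and "z \<in> open_strip \<Longrightarrow> \<exists>D. has_cderiv F D z"
  using assms unfolding calderon_def by blast+

lemma calderon_edge:
  assumes "F \<in> calderon" "j \<in> {0, 1}"
  shows "edge j F t \<in> pts (couple j)"
    and "((\<lambda>s. nrm (couple j) (edge j F s - edge j F t)) \<longlongrightarrow> 0) (at t)"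
    and "((\<lambda>t. nrm (couple j) (edge j F t)) \<longlongrightarrow> 0) at_infinity"
  using assms unfolding calderon_def continuous_into_def by blast+

text \<open>The edge norm is continuous by the reverse triangle inequality and vanishes at infinity.
  Boundedness is what gives the real supremum in \<open>calderon_norm\<close> its meaning.\<close>

lemma calderon_edge_bdd_above:
  assumes "F \<in> calderon" "j \<in> {0, 1}"
  shows "bdd_above (range (\<lambda>t. nrm (couple j) (edge j F t)))"
proof -
  let ?n = "\<lambda>t. nrm (couple j) (edge j F t)"
  have "isCont ?n t" for t
    unfolding isCont_def
  proof (rule LIM_zero_cancel, rule Lim_null_comparison[OF _ calderon_edge(2)[OF assms]])
    show "\<forall>\<^sub>F s in at t. norm (?n s - ?n t) \<le> nrm (couple j) (edge j F s - edge j F t)"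
      using nrm_couple_reverse[OF calderon_edge(1)[OF assms] calderon_edge(1)[OF assms]]
      by (intro always_eventually) simp
  qed
  then have cont: "continuous_on S ?n" for S
    by (simp add: continuous_at_imp_continuous_on)
  have "\<forall>\<^sub>F t in at_infinity. ?n t < 1"
    by (rule order_tendstoD(2)[OF calderon_edge(3)[OF assms]]) simp
  then obtain R where R: "\<And>t. R \<le> \<bar>t\<bar> \<Longrightarrow> ?n t < 1"
    unfolding eventually_at_infinity by auto
  have "bounded (?n ` {-R..R})"
    by (intro compact_imp_bounded compact_continuous_image cont) simp
  then obtain B where B: "\<forall>t\<in>{-R..R}. \<bar>?n t\<bar> \<le> B"
    unfolding bounded_iff by auto
  have "?n t \<le> max B 1" for t
  proof (cases "R \<le> \<bar>t\<bar>")
    case True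
    then show ?thesis using R[of t] by simp
  next
    case False
    then have "t \<in> {-R..R}" by auto
    then show ?thesis using bspec[OF B, of t] by simp
  qed
  then show ?thesis by (auto intro!: bdd_aboveI[of _ "max B 1"])
qed

lemma calderon_norm_le_iff:
  assumes "F \<in> calderon"
  shows "calderon_norm F \<le> N \<longleftrightarrow> (\<forall>j\<in>{0, 1}. \<forall>t. nrm (couple j) (edge j F t) \<le> N)"
  using calderon_edge_bdd_above[OF assms, of 0] calderon_edge_bdd_above[OF assms, of 1]
  by (simp add: calderon_norm_def cSUP_le_iff)

lemma calderon_norm_edge:
  assumes "F \<in> calderon" "j \<in> {0, 1}"
  shows "nrm (couple j) (edge j F t) \<le> calderon_norm F"
  using calderon_norm_le_iff[OF assms(1), of "calderon_norm F"] assms(2) by blast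

lemma calderon_norm_nonneg:
  assumes "F \<in> calderon"
  shows "0 \<le> calderon_norm F"
  using calderon_norm_edge[OF assms, of 0 0] nrm_couple_nonneg[OF calderon_edge(1)[OF assms, of 0 0]]
  by simp

lemma calderon_coord_holomorphic:
  assumes "F \<in> calderon"
  shows "coord_holomorphic F open_strip"
  unfolding coord_holomorphic_def
proof (intro conjI allI ballI)
  fix n
  have "\<exists>D. ((\<lambda>z. F z n) has_field_derivative D) (at z)" if "z \<in> open_strip" for z
    using assms that has_cderiv_coordinate unfolding calderon_def by blast
  then show "(\<lambda>z. F z n) holomorphic_on open_strip"
    by (simp add: holomorphic_on_open[OF open_open_strip])
next
  fix z assume "z \<in> open_strip"
  then obtain r where "r > 0" "cball z r \<subseteq> open_strip"
    using open_open_strip open_contains_cball by blast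
  moreover obtain M where "\<And>w. w \<in> strip \<Longrightarrow> norm (F w) \<le> M"
    using assms unfolding calderon_def bounded_iff by auto
  ultimately show "\<exists>r>0. \<exists>M. cball z r \<subseteq> open_strip \<and> (\<forall>w\<in>cball z r. norm (F w) \<le> M)"
    using open_strip_subset by blast
qed

lemma calderon_coord:
  assumes "F \<in> calderon"
  shows "(\<lambda>z. F z n) holomorphic_on open_strip"
    and "continuous_on strip (\<lambda>z. F z n)"
  using calderon_coord_holomorphic[OF assms] assms
    bounded_linear.continuous_on[OF bounded_linear_apply_bcontfun]
  unfolding coord_holomorphic_def calderon_def by blast+

section \<open>Scalar Taylor coefficients at the centre\<close>

lemma half_in_open_strip [simp]: "1 / 2 \<in> open_strip"
  by (simp add: open_strip_def)

text \<open>The scalar counterpart of \<open>delta\<close>. Dividing by the factorial turns the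
  Leibniz rule into the convolution rule \<open>jet_mult\<close>.\<close>

definition jet :: "nat \<Rightarrow> (complex \<Rightarrow> complex) \<Rightarrow> complex"
  where "jet k f = (deriv ^^ k) f (1 / 2) / fact k"

lemma delta_coordinate:
  assumes "F \<in> calderon"
  shows "apply_bcontfun (delta k F) n = jet k (\<lambda>z. F z n)"
  using higher_cderiv_coordinate[OF calderon_coord_holomorphic[OF assms] open_open_strip, of "1/2" k n]
  by (simp add: delta_def jet_def scaleR_conv_of_real divide_simps)

lemma jet_add:
  assumes "f holomorphic_on open_strip" "g holomorphic_on open_strip"
  shows "jet k (\<lambda>z. f z + g z) = jet k f + jet k g"
  using higher_deriv_add[OF assms open_open_strip, of "1/2" k]
  by (simp add: jet_def add_divide_distrib)

lemma jet_cmult: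
  assumes "f holomorphic_on open_strip"
  shows "jet k (\<lambda>z. c * f z) = c * jet k f"
  using higher_deriv_cmult[OF assms _ open_open_strip, of "1/2" k c]
  by (simp add: jet_def)

lemma jet_sum:
  assumes "\<And>i. i \<in> A \<Longrightarrow> f i holomorphic_on open_strip"
  shows "jet k (\<lambda>z. \<Sum>i\<in>A. f i z) = (\<Sum>i\<in>A. jet k (f i))"
  using assms
proof (induction A rule: infinite_finite_induct)
  case (insert a A)
  then show ?case by (simp add: jet_add holomorphic_on_sum)
qed (simp_all add: jet_def)

lemma jet_cong:
  assumes "f holomorphic_on open_strip" "\<And>z. z \<in> open_strip \<Longrightarrow> f z = g z"
  shows "jet k f = jet k g"
  unfolding jet_def
  by (subst higher_deriv_transform_within_open[where g = g, OF assms(1) _ open_open_strip])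
    (use assms in \<open>auto intro: holomorphic_transform\<close>)

lemma jet_mult:
  assumes "f holomorphic_on open_strip" "g holomorphic_on open_strip"
  shows "jet k (\<lambda>z. f z * g z) = (\<Sum>i\<le>k. jet i f * jet (k - i) g)"
proof -
  have "jet k (\<lambda>z. f z * g z) = (\<Sum>i\<le>k. of_nat (k choose i) / fact k * ((deriv ^^ i) f (1 / 2) * (deriv ^^ (k - i)) g (1 / 2)))"
    using higher_deriv_mult[OF assms open_open_strip, of "1/2" k]
    by (simp add: jet_def atMost_atLeast0 sum_divide_distrib mult.assoc)
  also have "\<dots> = (\<Sum>i\<le>k. jet i f * jet (k - i) g)"
    by (intro sum.cong refl) (simp add: jet_def binomial_fact divide_simps)
  finally show ?thesis .
qed

section \<open>Linear combinations in the Calderon space\<close>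

lemma calderonI:
  assumes "\<And>z. z \<notin> strip \<Longrightarrow> F z = 0" "continuous_on strip F" "bounded (F ` strip)"
    and "\<And>z. z \<in> open_strip \<Longrightarrow> \<exists>D. has_cderiv F D z"
    and "\<And>j t. j \<in> {0, 1} \<Longrightarrow> edge j F t \<in> pts (couple j)"
    and "\<And>j t. j \<in> {0, 1} \<Longrightarrow> ((\<lambda>s. nrm (couple j) (edge j F s - edge j F t)) \<longlongrightarrow> 0) (at t)"
    and "\<And>j. j \<in> {0, 1} \<Longrightarrow> ((\<lambda>t. nrm (couple j) (edge j F t)) \<longlongrightarrow> 0) at_infinity"
  shows "F \<in> calderon"
  unfolding calderon_def continuous_into_def mem_Collect_eq
proof (intro conjI allI impI ballI)
  show "range (edge j F) \<subseteq> pts (couple j)" if "j \<in> {0, 1}" for j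
    using assms(5)[OF that] by blast
qed (fact assms)+

text \<open>One combination covers sums and multiples; the differences used later are the case
  \<open>c = -1\<close>.\<close>

lemma calderon_lin:
  assumes F: "F \<in> calderon" and G: "G \<in> calderon"
  shows "(\<lambda>z. F z + c *\<^sub>C G z) \<in> calderon"
proof (rule calderonI)
  let ?H = "\<lambda>z. F z + c *\<^sub>C G z"
  show "?H z = 0" if "z \<notin> strip" for z
    using calderonD(1)[OF F that] calderonD(1)[OF G that] by simp
  show "continuous_on strip ?H"
    by (intro continuous_on_add bounded_linear.continuous_on[OF bounded_linear_scaleC_right]
        calderonD(2) F G)
  show "bounded (?H ` strip)"
  proof -
    have "bounded ((\<lambda>z. c *\<^sub>C G z) ` strip)"
      using bounded_linear_image[OF _ bounded_linear_scaleC_right, of "G ` strip" c] calderonD(3)[OF G]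
      by (simp add: image_image)
    with calderonD(3)[OF F] show ?thesis by (rule bounded_plus_comp)
  qed
  show "\<exists>D. has_cderiv ?H D z" if z: "z \<in> open_strip" for z
  proof -
    obtain D E where "has_cderiv F D z" "has_cderiv G E z"
      using calderonD(4)[OF F z] calderonD(4)[OF G z] by blast
    then have "(?H has_derivative (\<lambda>h. h *\<^sub>C D + c *\<^sub>C h *\<^sub>C E)) (at z)"
      unfolding has_cderiv_def
      by (intro has_derivative_add bounded_linear.has_derivative[OF bounded_linear_scaleC_right])
    then have "has_cderiv ?H (D + c *\<^sub>C E) z"
      by (simp add: has_cderiv_def scaleC_add_right scaleC_scaleC mult.commute)
    then show ?thesis by blast
  qed
  fix j :: nat assume j: "j \<in> {0, 1}"
  note edgeF = calderon_edge(1)[OF F j] and edgeG = calderon_edge(1)[OF G j]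
  have edge: "edge j ?H t = edge j F t + c *\<^sub>C edge j G t" for t
    by (simp add: edge_def)
  show edgeH: "edge j ?H t \<in> pts (couple j)" for t
    unfolding edge by (rule couple_lin[OF edgeF edgeG])
  show "((\<lambda>s. nrm (couple j) (edge j ?H s - edge j ?H t)) \<longlongrightarrow> 0) (at t)" for t
  proof (rule Lim_null_comparison[OF always_eventually[OF allI]])
    fix s
    have "edge j ?H s - edge j ?H t = (edge j F s - edge j F t) + c *\<^sub>C (edge j G s - edge j G t)"
      unfolding edge using scaleC_add_right[of c "edge j G s - edge j G t" "edge j G t"] by simp
    then have "nrm (couple j) (edge j ?H s - edge j ?H t) \<le>
      nrm (couple j) (edge j F s - edge j F t) + cmod c * nrm (couple j) (edge j G s - edge j G t)"
      by (simp only: nrm_couple_lin couple_diff edgeF edgeG)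
    then show "norm (nrm (couple j) (edge j ?H s - edge j ?H t)) \<le>
      nrm (couple j) (edge j F s - edge j F t) + cmod c * nrm (couple j) (edge j G s - edge j G t)"
      by (simp only: real_norm_def abs_of_nonneg[OF nrm_couple_nonneg[OF couple_diff[OF edgeH edgeH]]])
    show "((\<lambda>s. nrm (couple j) (edge j F s - edge j F t)
        + cmod c * nrm (couple j) (edge j G s - edge j G t)) \<longlongrightarrow> 0) (at t)"
      using tendsto_add[OF calderon_edge(2)[OF F j] tendsto_mult_left[OF calderon_edge(2)[OF G j], where c = "cmod c"], of t]
      by simp
  qed
  show "((\<lambda>t. nrm (couple j) (edge j ?H t)) \<longlongrightarrow> 0) at_infinity"
  proof (rule Lim_null_comparison[OF always_eventually[OF allI]])
    show "norm (nrm (couple j) (edge j ?H t)) \<le> nrm (couple j) (edge j F t) + cmod c * nrm (couple j) (edge j G t)" for t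
      using nrm_couple_lin[OF edgeF edgeG] nrm_couple_nonneg[OF edgeH]
      by (simp only: real_norm_def abs_of_nonneg edge)
    show "((\<lambda>s. nrm (couple j) (edge j F s) + cmod c * nrm (couple j) (edge j G s)) \<longlongrightarrow> 0) at_infinity"
      using tendsto_add[OF calderon_edge(3)[OF F j] tendsto_mult_left[OF calderon_edge(3)[OF G j], where c = "cmod c"]]
      by simp
  qed
qed

lemma calderon_norm_lin:
  assumes F: "F \<in> calderon" and G: "G \<in> calderon"
  shows "calderon_norm (\<lambda>z. F z + c *\<^sub>C G z) \<le> calderon_norm F + cmod c * calderon_norm G"
  unfolding calderon_norm_le_iff[OF calderon_lin[OF F G]]
proof (intro ballI allI)
  fix j :: nat and t assume j: "j \<in> {0, 1}"
  have "edge j (\<lambda>z. F z + c *\<^sub>C G z) t = edge j F t + c *\<^sub>C edge j G t"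
    by (simp add: edge_def)
  then have "nrm (couple j) (edge j (\<lambda>z. F z + c *\<^sub>C G z) t) \<le> nrm (couple j) (edge j F t) + cmod c * nrm (couple j) (edge j G t)"
    by (simp only: nrm_couple_lin calderon_edge(1)[OF F j] calderon_edge(1)[OF G j])
  also have "\<dots> \<le> calderon_norm F + cmod c * calderon_norm G"
    by (intro add_mono mult_left_mono calderon_norm_edge F G j) simp
  finally show "nrm (couple j) (edge j (\<lambda>z. F z + c *\<^sub>C G z) t) \<le> calderon_norm F + cmod c * calderon_norm G" .
qed

lemma delta_lin:
  assumes F: "F \<in> calderon" and G: "G \<in> calderon"
  shows "delta k (\<lambda>z. F z + c *\<^sub>C G z) = delta k F + c *\<^sub>C delta k G"
proof (rule bcontfun_eqI)
  fix n
  show "apply_bcontfun (delta k (\<lambda>z. F z + c *\<^sub>C G z)) n = apply_bcontfun (delta k F + c *\<^sub>C delta k G) n"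
    by (simp add: delta_coordinate[OF calderon_lin[OF F G]] delta_coordinate[OF F] delta_coordinate[OF G]
        jet_add jet_cmult calderon_coord(1)[OF F] calderon_coord(1)[OF G] holomorphic_on_mult)
qed

section \<open>Jets at the centre of the strip\<close>

text \<open>Multiplying a function with Taylor coefficients \<open>y\<close> at \<open>1/2\<close> by \<open>exp (l * (z - 1/2))\<close> yields
  the Taylor coefficients bounded here.\<close>

definition jet_le :: "real \<Rightarrow> real \<Rightarrow> (nat \<Rightarrow> complex) \<Rightarrow> bool"
  where "jet_le l Q y \<longleftrightarrow> cmod (y 0) \<le> Q \<and> cmod (y 1 + l * y 0) \<le> Q \<and>
    cmod (y 2 + l * y 1 + l\<^sup>2 / 2 * y 0) \<le> Q"

text \<open>Each of the three quantities bounded in \<open>jet_le\<close> is linear in the jet, so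
  the condition is convex.\<close>

lemma jet_le_average:
  assumes "\<And>m. m \<in> A \<Longrightarrow> jet_le l Q (y m)" "finite A" "A \<noteq> {}"
  shows "jet_le l Q (\<lambda>n. (\<Sum>m\<in>A. y m n) / of_nat (card A))"
proof -
  have avg: "cmod ((\<Sum>m\<in>A. f m) / of_nat (card A)) \<le> Q" if "\<And>m. m \<in> A \<Longrightarrow> cmod (f m) \<le> Q" for f
  proof -
    have "cmod (\<Sum>m\<in>A. f m) \<le> of_nat (card A) * Q"
      using sum_norm_bound[of A f Q] that by simp
    then show ?thesis using assms(2,3)
      by (simp add: norm_divide divide_simps card_gt_0_iff mult.commute)
  qed
  show ?thesis
    using avg[of "\<lambda>m. y m 0"] avg[of "\<lambda>m. y m 1 + l * y m 0"]
      avg[of "\<lambda>m. y m 2 + l * y m 1 + l\<^sup>2 / 2 * y m 0"] assms(1)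
    by (simp add: jet_le_def sum.distrib sum_distrib_left add_divide_distrib)
qed

lemma jet_exp:
  "jet 0 (\<lambda>z. exp (of_real l * (z - 1/2))) = 1"
  "jet 1 (\<lambda>z. exp (of_real l * (z - 1/2))) = of_real l"
  "jet 2 (\<lambda>z. exp (of_real l * (z - 1/2))) = (of_real l)\<^sup>2 / 2"
proof -
  have d1: "deriv (\<lambda>z::complex. exp (of_real l * (z - 1/2))) = (\<lambda>z. of_real l * exp (of_real l * (z - 1/2)))"
    by (rule ext, rule DERIV_imp_deriv) (auto intro!: derivative_eq_intros)
  have d2: "deriv (\<lambda>z::complex. of_real l * exp (of_real l * (z - 1/2))) = (\<lambda>z. (of_real l)\<^sup>2 * exp (of_real l * (z - 1/2)))"
    by (rule ext, rule DERIV_imp_deriv) (auto intro!: derivative_eq_intros simp: power2_eq_square)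
  show "jet 0 (\<lambda>z. exp (of_real l * (z - 1/2))) = 1"
    "jet 1 (\<lambda>z. exp (of_real l * (z - 1/2))) = of_real l"
    "jet 2 (\<lambda>z. exp (of_real l * (z - 1/2))) = (of_real l)\<^sup>2 / 2"
    using d1 d2 by (simp_all add: jet_def numeral_2_eq_2)
qed

lemma jet_mult_le_2:
  assumes "f holomorphic_on open_strip" "g holomorphic_on open_strip"
  shows "jet 0 (\<lambda>z. f z * g z) = jet 0 f * jet 0 g"
    and "jet 1 (\<lambda>z. f z * g z) = jet 0 f * jet 1 g + jet 1 f * jet 0 g"
    and "jet 2 (\<lambda>z. f z * g z) = jet 0 f * jet 2 g + jet 1 f * jet 1 g + jet 2 f * jet 0 g"
  unfolding jet_mult[OF assms] by (simp_all add: numeral_2_eq_2)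

text \<open>The closed disc of radius 1/4 about 1/2 lies in the open strip, so Cauchy's inequality
  gives \<open>4 ^ k * M\<close>, at most \<open>16 * M\<close> for
  \<open>k \<le> 2\<close>.\<close>

lemma jet_bound:
  assumes hol: "g holomorphic_on open_strip" and bd: "\<And>z. z \<in> open_strip \<Longrightarrow> cmod (g z) \<le> M" and k: "k \<le> 2"
  shows "cmod (jet k g) \<le> 16 * M"
proof -
  have M: "0 \<le> M" using bd[OF half_in_open_strip] norm_ge_zero order_trans by blast
  have sub: "cball (1/2) (1/4) \<subseteq> open_strip"
  proof
    fix z :: complex assume "z \<in> cball (1/2) (1/4)"
    then have "\<bar>Re z - 1/2\<bar> \<le> 1/4"
      using abs_Re_le_cmod[of "z - 1/2"] by (simp add: dist_norm norm_minus_commute)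
    then show "z \<in> open_strip" unfolding open_strip_def mem_Collect_eq by linarith
  qed
  have "cmod ((deriv ^^ k) g (1/2)) \<le> fact k * M / (1/4) ^ k"
  proof (rule Cauchy_inequality)
    show "g holomorphic_on ball (1/2) (1/4)"
      using hol sub by (meson ball_subset_cball holomorphic_on_subset order_trans)
    show "continuous_on (cball (1/2) (1/4)) g"
      using hol sub by (meson holomorphic_on_imp_continuous_on holomorphic_on_subset)
    show "cmod (g x) \<le> M" if "cmod (1 / 2 - x) = 1/4" for x
      using that sub by (intro bd) (auto simp: dist_norm)
  qed simp
  then have "cmod (jet k g) \<le> 4 ^ k * M"
    by (simp add: jet_def norm_divide power_one_over divide_simps mult_ac)
  also have "(4::real) ^ k \<le> 4 ^ 2" using k by (intro power_increasing) auto
  then have "4 ^ k * M \<le> 16 * M" using M by (intro mult_right_mono) auto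
  finally show ?thesis .
qed

text \<open>The average of \<open>k = exp l\<close> coordinates is bounded by \<open>N\<close> on the left edge and by \<open>N / k\<close> on
  the right edge, so that multiplication by \<open>k powr (z - 1/2)\<close> balances the two bounds.\<close>

lemma calderon_jet_le:
  assumes G: "G \<in> calderon" and N: "calderon_norm G \<le> N" "N > 0"
    and A: "finite A" "A \<noteq> {}" and c: "\<And>i. i \<in> A \<Longrightarrow> cmod (c i) \<le> 1"
    and l: "l = ln (real (card A))"
  shows "jet_le l (16 * (N * exp (- l / 2))) (\<lambda>n. (\<Sum>i\<in>A. c i * apply_bcontfun (delta n G) i) / of_nat (card A))"
proof -
  let ?k = "card A"
  have k: "real ?k > 0" using A by (simp add: card_gt_0_iff)
  have expl: "exp l = ?k" using k l by simp
  define f where "f z = (1 / of_nat ?k) * (\<Sum>i\<in>A. c i * G z i)" for z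
  define g where "g z = f z * exp (of_real l * (z - 1/2))" for z :: complex
  have holf: "f holomorphic_on open_strip"
    unfolding f_def by (intro holomorphic_intros calderon_coord(1)[OF G])
  have holg: "g holomorphic_on open_strip"
    unfolding g_def by (intro holomorphic_intros holf)
  have contg: "continuous_on strip g"
    unfolding g_def f_def by (intro continuous_intros calderon_coord(2)[OF G])
  have jetf: "jet n f = (\<Sum>i\<in>A. c i * apply_bcontfun (delta n G) i) / of_nat ?k" for n
    unfolding f_def
    by (subst jet_cmult, intro holomorphic_intros calderon_coord(1)[OF G],
      subst jet_sum, intro holomorphic_intros calderon_coord(1)[OF G])
      (simp add: jet_cmult calderon_coord(1)[OF G] delta_coordinate[OF G])
  have fl1: "cmod (f z) \<le> (\<Sum>i\<in>A. cmod (G z i)) / ?k" for z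
  proof -
    have "cmod (\<Sum>i\<in>A. c i * G z i) \<le> (\<Sum>i\<in>A. cmod (G z i))"
      by (rule order_trans[OF norm_sum], rule sum_mono)
        (simp add: norm_mult mult_left_le_one_le c)
    then show ?thesis using k by (simp add: f_def norm_mult norm_divide divide_simps)
  qed
  have fsup: "cmod (f z) \<le> norm (G z)" for z
  proof -
    have "(\<Sum>i\<in>A. cmod (G z i)) \<le> real ?k * norm (G z)"
      using sum_bounded_above[of A "\<lambda>i. cmod (G z i)" "norm (G z)"] by (simp add: norm_bounded)
    moreover have "real ?k * cmod (f z) \<le> (\<Sum>i\<in>A. cmod (G z i))"
      using fl1[of z] k by (simp add: divide_simps mult.commute)
    ultimately have "real ?k * cmod (f z) \<le> real ?k * norm (G z)"
      by (rule order_trans[rotated])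
    then show ?thesis by (rule mult_left_le_imp_le[OF _ k])
  qed
  have normg: "cmod (g z) = cmod (f z) * exp (l * (Re z - 1/2))" for z
    by (simp add: g_def norm_mult)
  obtain M where M: "\<And>z. z \<in> strip \<Longrightarrow> norm (G z) \<le> M"
    using calderonD(3)[OF G] unfolding bounded_iff by auto
  have l0: "l \<ge> 0" using l k by simp
  have bound: "cmod (g z) \<le> N * exp (- l / 2)" if z: "z \<in> strip" for z
  proof (rule maximum_principle_strip[OF contg holg _ _ _ _ z])
    \<comment> \<open>Any a priori bound suffices here; the exponent \<open>l * (Re z - 1/2)\<close>
      is at most \<open>l\<close> on the strip.\<close>
    fix z assume "z \<in> strip"
    then show "cmod (g z) \<le> M * exp l"
      unfolding normg using l0 M[of z] fsup[of z]
      by (intro mult_mono) (auto simp: strip_def intro: order_trans[OF norm_ge_zero] mult_left_le)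
  next
    fix z :: complex assume z: "Re z = 0"
    have "edge 0 G (Im z) = G z" using z by (metis edge_def complex_eq of_nat_0 of_real_0)
    then have "norm (G z) \<le> N"
      using calderon_norm_edge[OF G, of 0 "Im z"] N by (simp add: couple_def linf_space_def)
    then show "cmod (g z) \<le> N * exp (- l / 2)"
      unfolding normg using fsup[of z] z by simp
  next
    fix z :: complex assume z: "Re z = 1"
    have "edge 1 G (Im z) = G z" using z by (metis edge_def complex_eq of_nat_1 of_real_1)
    then have "summable (\<lambda>n. cmod (G z n))" "(\<Sum>n. cmod (G z n)) \<le> N"
      using calderon_norm_edge[OF G, of 1 "Im z"] calderon_edge(1)[OF G, of 1 "Im z"] N
      by (simp_all add: couple_def l1_space_def)
    then have "(\<Sum>i\<in>A. cmod (G z i)) \<le> N"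
      using sum_le_suminf[of "\<lambda>n. cmod (G z n)" A] A by simp
    then have "cmod (f z) \<le> N / ?k" using fl1[of z] k by (simp add: divide_simps)
    then have "cmod (g z) \<le> N / ?k * exp (l * (1/2))"
      using mult_right_mono[of "cmod (f z)" "N / ?k" "exp (l * (1/2))"] unfolding normg z by simp
    also have "N / ?k * exp (l * (1/2)) = N * (exp (l * (1/2)) / ?k)"
      by simp
    also have "exp (l * (1/2)) / ?k = exp (- l / 2)"
      unfolding expl[symmetric] exp_diff[symmetric] by simp
    finally show "cmod (g z) \<le> N * exp (- l / 2)" .
  qed (use N in simp)
  have jet: "cmod (jet n g) \<le> 16 * (N * exp (- l / 2))" if "n \<le> 2" for n
    using jet_bound[OF holg _ that] bound open_strip_subset by blast
  have hole: "(\<lambda>z. exp (of_real l * (z - 1/2))) holomorphic_on open_strip"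
    by (intro holomorphic_intros)
  have "jet 0 g = jet 0 f" "jet 1 g = jet 1 f + of_real l * jet 0 f"
    "jet 2 g = jet 2 f + of_real l * jet 1 f + (of_real l)\<^sup>2 / 2 * jet 0 f"
    unfolding g_def jet_mult_le_2[OF holf hole] jet_exp
    by (simp_all add: algebra_simps)
  with jet[of 0] jet[of 1] jet[of 2] show ?thesis
    by (simp add: jet_le_def jetf[symmetric])
qed

section \<open>Test functions\<close>

definition unit_seq :: "nat \<Rightarrow> linf"
  where "unit_seq j = Bcontfun (\<lambda>i. if i = j then 1 else 0)"

lemma apply_unit_seq [simp]: "apply_bcontfun (unit_seq j) i = (if i = j then 1 else 0)"
  unfolding unit_seq_def by (subst apply_Bcontfun_linf[where M = 1]) auto

lemma apply_sum_unit_seq: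
  "finite A \<Longrightarrow> apply_bcontfun (\<Sum>j\<in>A. \<epsilon> j *\<^sub>C unit_seq j) i = (if i \<in> A then \<epsilon> i else 0)"
  by (simp add: apply_sum_bcontfun if_distrib[where f = "\<lambda>x. _ * x"] cong: if_cong)

text \<open>The bounds for the two endpoint norms of a block of \<open>k\<close> coordinates differ
  by the factor \<open>k = exp l\<close>; this discrepancy is the source of the logarithm
  \<open>l\<close> in the later estimates.\<close>

lemma
  assumes A: "finite A" and \<epsilon>: "\<And>i. i \<in> A \<Longrightarrow> cmod (\<epsilon> i) \<le> 1"
  shows sum_unit_seq_couple: "(\<Sum>j\<in>A. \<epsilon> j *\<^sub>C unit_seq j) \<in> pts (couple m)"
    and nrm_sum_unit_seq_0: "nrm (couple 0) (\<Sum>j\<in>A. \<epsilon> j *\<^sub>C unit_seq j) \<le> 1"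
    and nrm_sum_unit_seq_1: "nrm (couple 1) (\<Sum>j\<in>A. \<epsilon> j *\<^sub>C unit_seq j) \<le> card A"
proof -
  let ?u = "\<Sum>j\<in>A. \<epsilon> j *\<^sub>C unit_seq j"
  have sums: "(\<lambda>i. cmod (apply_bcontfun ?u i)) sums (\<Sum>i\<in>A. cmod (apply_bcontfun ?u i))"
    by (rule sums_finite[OF A]) (simp only: apply_sum_unit_seq[OF A] if_False norm_zero)
  then show "?u \<in> pts (couple m)"
    unfolding couple_def linf_space_def l1_space_def by (auto intro: sums_summable)
  have "norm ?u \<le> 1"
    by (rule norm_bound) (simp only: apply_sum_unit_seq[OF A], simp add: \<epsilon>)
  then show "nrm (couple 0) ?u \<le> 1"
    by (simp add: couple_def linf_space_def)
  have "(\<Sum>i\<in>A. cmod (apply_bcontfun ?u i)) \<le> (\<Sum>i\<in>A. 1)"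
    by (rule sum_mono) (simp only: apply_sum_unit_seq[OF A] if_True \<epsilon>)
  with sums_unique[OF sums] show "nrm (couple 1) ?u \<le> card A"
    by (simp add: couple_def l1_space_def)
qed

text \<open>Products of an entire scalar function with a fixed vector supply the test functions.
  Cutting off outside the strip leaves the Taylor coefficients at the interior point 1/2
  unchanged.\<close>

lemma calderon_scalar:
  assumes h: "h holomorphic_on UNIV" and bd: "\<And>z. z \<in> strip \<Longrightarrow> cmod (h z) \<le> M"
    and lim: "\<And>j. j \<in> {0, 1} \<Longrightarrow> ((\<lambda>t. edge j h t) \<longlongrightarrow> 0) at_infinity"
    and u: "\<And>j. u \<in> pts (couple j)"
  defines "F \<equiv> \<lambda>z. if z \<in> strip then h z *\<^sub>C u else 0"
  shows "F \<in> calderon" and "delta k F = jet k h *\<^sub>C u"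
    and "\<And>j t. j \<in> {0, 1} \<Longrightarrow> nrm (couple j) (edge j F t) = cmod (edge j h t) * nrm (couple j) u"
proof -
  have conth: "continuous_on S h" for S
    using h holomorphic_on_imp_continuous_on holomorphic_on_subset by blast
  have edge_strip: "of_nat j + \<i> * of_real t \<in> strip" if "j \<in> {0, 1}" for j :: nat and t
    using that by (auto simp: strip_def)
  then have edge: "edge j F t = edge j h t *\<^sub>C u" if "j \<in> {0, 1}" for j t
    using that by (auto simp: edge_def F_def)
  show nrm_edge: "nrm (couple j) (edge j F t) = cmod (edge j h t) * nrm (couple j) u" if "j \<in> {0, 1}" for j t
    unfolding edge[OF that] by (rule nrm_couple_scaleC[OF u])
  show F: "F \<in> calderon"
  proof (rule calderonI)
    show "F z = 0" if "z \<notin> strip" for z using that by (simp add: F_def)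
    have "continuous_on strip (\<lambda>z. h z *\<^sub>C u)"
      by (rule bounded_linear.continuous_on[OF bounded_linear_scaleC_left conth])
    then show "continuous_on strip F"
      by (rule continuous_on_eq) (simp add: F_def)
    show "bounded (F ` strip)"
      unfolding bounded_iff
      by (auto simp: F_def norm_scaleC intro!: exI[of _ "M * norm u"] mult_right_mono bd)
    show "\<exists>D. has_cderiv F D z" if z: "z \<in> open_strip" for z
    proof -
      have "(h has_derivative (\<lambda>x. x * deriv h z)) (at z)"
        using holomorphic_derivI[OF h open_UNIV, of z] by (simp add: has_field_derivative_def mult_commute_abs)
      from bounded_linear.has_derivative[OF bounded_linear_scaleC_left this]
      have "((\<lambda>z. h z *\<^sub>C u) has_derivative (\<lambda>x. x *\<^sub>C deriv h z *\<^sub>C u)) (at z)"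
        by (simp add: scaleC_scaleC)
      then have "(F has_derivative (\<lambda>x. x *\<^sub>C deriv h z *\<^sub>C u)) (at z)"
        by (rule has_derivative_transform_within_open[OF _ open_open_strip z])
          (use open_strip_subset in \<open>auto simp: F_def\<close>)
      then show ?thesis unfolding has_cderiv_def by blast
    qed
    fix j :: nat assume j: "j \<in> {0, 1}"
    show "edge j F t \<in> pts (couple j)" for t
      unfolding edge[OF j] by (rule couple_scaleC[OF u])
    show "((\<lambda>s. nrm (couple j) (edge j F s - edge j F t)) \<longlongrightarrow> 0) (at t)" for t
    proof -
      have "edge j F s - edge j F t = (edge j h s - edge j h t) *\<^sub>C u" for s
        unfolding edge[OF j] using scaleC_add_left[of "edge j h s - edge j h t" "edge j h t" u] by simp
      then have "nrm (couple j) (edge j F s - edge j F t) = cmod (edge j h s - edge j h t) * nrm (couple j) u" for s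
        by (simp only: nrm_couple_scaleC[OF u])
      moreover have "continuous_on UNIV (\<lambda>s. edge j h s)"
        unfolding edge_def by (intro continuous_on_compose2[OF conth[of UNIV]] continuous_intros) auto
      then have "((\<lambda>s. edge j h s) \<longlongrightarrow> edge j h t) (at t)"
        by (simp add: continuous_on_eq_continuous_at isCont_def)
      then have "((\<lambda>s. cmod (edge j h s - edge j h t) * nrm (couple j) u) \<longlongrightarrow> 0) (at t)"
        by (auto intro!: tendsto_eq_intros)
      ultimately show ?thesis by simp
    qed
    show "((\<lambda>t. nrm (couple j) (edge j F t)) \<longlongrightarrow> 0) at_infinity"
      unfolding nrm_edge[OF j] using lim[OF j] by (auto intro!: tendsto_eq_intros)
  qed
  show "delta k F = jet k h *\<^sub>C u"
  proof (rule bcontfun_eqI)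
    fix n
    have holh: "h holomorphic_on open_strip" using h holomorphic_on_subset by blast
    have "jet k (\<lambda>z. apply_bcontfun u n * h z) = jet k (\<lambda>z. F z n)"
      using open_strip_subset by (intro jet_cong holomorphic_intros holh) (auto simp: F_def)
    then show "apply_bcontfun (delta k F) n = apply_bcontfun (jet k h *\<^sub>C u) n"
      unfolding delta_coordinate[OF F] jet_cmult[OF holh]
      by (simp add: mult.commute[of "apply_bcontfun u n"])
  qed
qed

text \<open>The Gaussian adds decay along vertical lines. The constant is \<open>2 * 3\<close>:
  \<open>exp ((Re w)^2)\<close> is at most 2, and the polynomial is at most
  \<open>3 * Q * (1 + (Im w)^2)\<close>.\<close>

lemma gaussian_polynomial:
  fixes p :: "nat \<Rightarrow> complex" and w :: complex
  assumes p: "cmod (p 0) \<le> Q" "cmod (p 1) \<le> Q" "cmod (p 2) \<le> 2 * Q" and w: "\<bar>Re w\<bar> \<le> 1/2"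
  shows "cmod (exp (w\<^sup>2) * (p 0 + p 1 * w + p 2 * w\<^sup>2)) \<le> 6 * Q * ((1 + (Im w)\<^sup>2) * exp (- (Im w)\<^sup>2))"
proof -
  have Q: "0 \<le> Q" using p(1) norm_ge_zero order_trans by blast
  have re2: "(Re w)\<^sup>2 \<le> 1/4"
    using power_mono[OF w, of 2] by (simp add: power2_eq_square)
  then have w2: "(cmod w)\<^sup>2 \<le> 1/4 + (Im w)\<^sup>2"
    by (simp add: cmod_power2)
  have w1: "cmod w \<le> (1 + (cmod w)\<^sup>2) / 2"
    using zero_le_power2[of "1 - cmod w"] by (simp add: power2_eq_square algebra_simps)
  have "cmod (p 0 + p 1 * w + p 2 * w\<^sup>2) \<le> cmod (p 0) + cmod (p 1 * w) + cmod (p 2 * w\<^sup>2)"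
    by (intro norm_triangle_le add_right_mono norm_triangle_ineq)
  also have "\<dots> \<le> Q + Q * cmod w + 2 * Q * (cmod w)\<^sup>2"
    using p by (auto simp: norm_mult norm_power intro!: add_mono mult_right_mono)
  also have "\<dots> = Q * (1 + cmod w + 2 * (cmod w)\<^sup>2)" by (simp add: algebra_simps)
  also have "\<dots> \<le> Q * (3 * (1 + (Im w)\<^sup>2))"
    using w1 w2 zero_le_power2[of "Im w"] by (intro mult_left_mono Q) argo
  finally have poly: "cmod (p 0 + p 1 * w + p 2 * w\<^sup>2) \<le> Q * (3 * (1 + (Im w)\<^sup>2))" .
  have "exp (1 / 2 * (1 / 2)) \<le> (2::real)"
    using exp_bound_half[of "1 / 2 * (1 / 2) :: real"] by simp
  then have "exp ((Re w)\<^sup>2) \<le> 2"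
    using re2 by (simp add: order_trans[rotated])
  then have "exp ((Re w)\<^sup>2) * exp (- (Im w)\<^sup>2) \<le> 2 * exp (- (Im w)\<^sup>2)"
    by (intro mult_right_mono) auto
  then have "cmod (exp (w\<^sup>2)) \<le> 2 * exp (- (Im w)\<^sup>2)"
    by (simp add: power2_eq_square exp_add[symmetric])
  from mult_mono[OF this poly]
  have "cmod (exp (w\<^sup>2)) * cmod (p 0 + p 1 * w + p 2 * w\<^sup>2)
    \<le> 2 * exp (- (Im w)\<^sup>2) * (Q * (3 * (1 + (Im w)\<^sup>2)))"
    by simp
  also have "\<dots> = 6 * Q * ((1 + (Im w)\<^sup>2) * exp (- (Im w)\<^sup>2))"
    by (simp add: algebra_simps)
  finally show ?thesis by (simp only: norm_mult)
qed

text \<open>A converse to \<open>calderon_jet_le\<close>. Up to a Gaussian correction, a quadratic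
  polynomial carries the Taylor coefficients of \<open>x\<close> multiplied by
  \<open>exp (l * (z - 1/2))\<close>, which \<open>jet_le\<close> bounds; the factor
  \<open>exp (- l * (z - 1/2))\<close> restores \<open>x\<close> and balances the two edge norms of
  the block.\<close>

lemma exists_calderon_jet:
  assumes x: "jet_le l Q x" and A: "finite A" "A \<noteq> {}" and \<epsilon>: "\<And>i. i \<in> A \<Longrightarrow> cmod (\<epsilon> i) \<le> 1"
    and l: "l = ln (real (card A))"
  obtains F where "F \<in> calderon" "calderon_norm F \<le> 6 * Q * exp (l / 2)"
    "\<And>n. n \<le> 2 \<Longrightarrow> delta n F = x n *\<^sub>C (\<Sum>j\<in>A. \<epsilon> j *\<^sub>C unit_seq j)"
proof -
  let ?u = "\<Sum>j\<in>A. \<epsilon> j *\<^sub>C unit_seq j"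
  have k: "real (card A) > 0" using A by (simp add: card_gt_0_iff)
  have expl: "exp l = card A" using k l by simp
  \<comment> \<open>The Gaussian \<open>exp (w^2)\<close> has second Taylor coefficient 1, so
    \<open>x 0\<close> is subtracted from the quadratic coefficient; this is why its bound is
    \<open>2 * Q\<close>.\<close>
  define p :: "nat \<Rightarrow> complex" where
    "p n = (if n = 0 then x 0 else if n = 1 then x 1 + l * x 0 else x 2 + l * x 1 + l\<^sup>2 / 2 * x 0 - x 0)" for n
  have p: "cmod (p 0) \<le> Q" "cmod (p 1) \<le> Q" "cmod (p 2) \<le> 2 * Q"
    using x norm_triangle_ineq4[of "x 2 + l * x 1 + l\<^sup>2 / 2 * x 0" "x 0"]
    by (simp_all add: jet_le_def p_def)
  have Q: "0 \<le> Q" using p(1) norm_ge_zero order_trans by blast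
  define P where "P w = p 0 + p 1 * w + p 2 * w\<^sup>2" for w
  define h where "h z = exp ((z - 1/2)\<^sup>2) * P (z - 1/2) * exp (of_real (-l) * (z - 1/2))" for z
  have hol: "h holomorphic_on UNIV"
    unfolding h_def P_def by (intro holomorphic_intros)
  have gauss: "cmod (exp ((z - 1/2)\<^sup>2) * P (z - 1/2)) \<le> 6 * Q * ((1 + (Im z)\<^sup>2) * exp (- (Im z)\<^sup>2))"
    if "z \<in> strip" for z
  proof -
    have "\<bar>Re (z - 1/2)\<bar> \<le> 1/2" using that by (auto simp: strip_def abs_if)
    from gaussian_polynomial[OF p this] show ?thesis by (simp add: P_def)
  qed
  have le1: "(1 + y\<^sup>2) * exp (- y\<^sup>2) \<le> 1" for y :: real
    using exp_ge_add_one_self[of "y\<^sup>2"] by (simp add: exp_minus divide_simps)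
  have norm_h: "cmod (h z) \<le> 6 * Q * ((1 + (Im z)\<^sup>2) * exp (- (Im z)\<^sup>2)) * exp (- l * (Re z - 1/2))"
    if "z \<in> strip" for z
    using mult_right_mono[OF gauss[OF that], of "exp (- l * (Re z - 1/2))"]
    unfolding h_def by (simp add: norm_mult)
  have norm_h': "cmod (h z) \<le> 6 * Q * exp (- l * (Re z - 1/2))" if "z \<in> strip" for z
  proof -
    have "6 * Q * ((1 + (Im z)\<^sup>2) * exp (- (Im z)\<^sup>2)) \<le> 6 * Q"
      using mult_left_mono[OF le1[of "Im z"], of "6 * Q"] Q by simp
    from mult_right_mono[OF this, of "exp (- l * (Re z - 1/2))"] show ?thesis
      using norm_h[OF that] by (rule order_trans[rotated]) simp
  qed
  have "l \<ge> 0" using l k by simp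
  then have bd: "cmod (h z) \<le> 6 * Q * exp l" if z: "z \<in> strip" for z
  proof -
    have "- l * (Re z - 1/2) \<le> l * 1"
      using mult_left_mono[of "1/2 - Re z" 1 l] \<open>l \<ge> 0\<close> z by (simp add: strip_def algebra_simps)
    then have "6 * Q * exp (- l * (Re z - 1/2)) \<le> 6 * Q * exp l"
      using Q by (intro mult_left_mono) auto
    then show ?thesis using norm_h'[OF z] by linarith
  qed
  have lim: "(edge j h \<longlongrightarrow> 0) at_infinity" if j: "j \<in> {0, 1}" for j
  proof (rule Lim_null_comparison[OF always_eventually[OF allI]])
    show "cmod (edge j h t) \<le> 6 * Q * ((1 + t\<^sup>2) * exp (- t\<^sup>2)) * exp (- l * (of_nat j - 1/2))" for t
      using norm_h[of "of_nat j + \<i> * of_real t"] j by (auto simp: edge_def strip_def)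
    have "((\<lambda>t::real. (1 + t\<^sup>2) * exp (- t\<^sup>2)) \<longlongrightarrow> 0) at_top"
      "((\<lambda>t::real. (1 + t\<^sup>2) * exp (- t\<^sup>2)) \<longlongrightarrow> 0) at_bot"
      by real_asymp+
    then have "((\<lambda>t::real. (1 + t\<^sup>2) * exp (- t\<^sup>2)) \<longlongrightarrow> 0) at_infinity"
      by (simp add: at_infinity_eq_at_top_bot filterlim_sup)
    then show "((\<lambda>t. 6 * Q * ((1 + t\<^sup>2) * exp (- t\<^sup>2)) * exp (- l * (of_nat j - 1/2))) \<longlongrightarrow> 0) at_infinity"
      by (intro tendsto_mult_left_zero tendsto_mult_right_zero)
  qed
  define F where "F = (\<lambda>z. if z \<in> strip then h z *\<^sub>C ?u else 0)"
  have u: "?u \<in> pts (couple m)" for m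
    using A(1) \<epsilon> by (rule sum_unit_seq_couple)
  note scalar = calderon_scalar[where h = h and u = ?u and M = "6 * Q * exp l", folded F_def]
  have F: "F \<in> calderon"
    by (rule scalar(1)) (fact hol bd lim u)+
  have delta_F: "delta n F = jet n h *\<^sub>C ?u" for n
    by (rule scalar(2)) (fact hol bd lim u)+
  have nrm_F: "nrm (couple j) (edge j F t) = cmod (edge j h t) * nrm (couple j) ?u"
    if "j \<in> {0, 1}" for j t
    by (rule scalar(3)) (fact hol bd lim u that)+
  have jet_P: "jet 0 (\<lambda>z. P (z - 1/2)) = p 0" "jet 1 (\<lambda>z. P (z - 1/2)) = p 1"
    "jet 2 (\<lambda>z. P (z - 1/2)) = p 2"
  proof -
    have "deriv (\<lambda>z. P (z - 1/2)) = (\<lambda>z. p 1 + 2 * p 2 * (z - 1/2))"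
      unfolding P_def by (rule ext, rule DERIV_imp_deriv) (auto intro!: derivative_eq_intros)
    moreover have "deriv (\<lambda>z. p 1 + 2 * p 2 * (z - 1/2)) = (\<lambda>z. 2 * p 2)"
      by (rule ext, rule DERIV_imp_deriv) (auto intro!: derivative_eq_intros)
    ultimately show "jet 0 (\<lambda>z. P (z - 1/2)) = p 0" "jet 1 (\<lambda>z. P (z - 1/2)) = p 1"
      "jet 2 (\<lambda>z. P (z - 1/2)) = p 2"
      by (simp_all add: jet_def numeral_2_eq_2, simp add: P_def)
  qed
  have jet_gauss: "jet 0 (\<lambda>z. exp ((z - 1/2)\<^sup>2)) = 1" "jet 1 (\<lambda>z. exp ((z - 1/2)\<^sup>2)) = 0"
    "jet 2 (\<lambda>z. exp ((z - 1/2)\<^sup>2)) = 1"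
  proof -
    have "deriv (\<lambda>z::complex. exp ((z - 1/2)\<^sup>2)) = (\<lambda>z. 2 * (z - 1/2) * exp ((z - 1/2)\<^sup>2))"
      by (rule ext, rule DERIV_imp_deriv) (auto intro!: derivative_eq_intros)
    moreover have "deriv (\<lambda>z::complex. 2 * (z - 1/2) * exp ((z - 1/2)\<^sup>2)) (1/2) = 2"
      by (rule DERIV_imp_deriv) (auto intro!: derivative_eq_intros)
    ultimately show "jet 0 (\<lambda>z. exp ((z - 1/2)\<^sup>2)) = 1" "jet 1 (\<lambda>z. exp ((z - 1/2)\<^sup>2)) = 0"
      "jet 2 (\<lambda>z. exp ((z - 1/2)\<^sup>2)) = 1"
      by (simp_all add: jet_def numeral_2_eq_2)
  qed
  have holE: "(\<lambda>z. exp ((z - 1/2)\<^sup>2)) holomorphic_on open_strip" "(\<lambda>z. P (z - 1/2)) holomorphic_on open_strip"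
    "(\<lambda>z. exp ((z - 1/2)\<^sup>2) * P (z - 1/2)) holomorphic_on open_strip"
    "(\<lambda>z. exp (of_real (-l) * (z - 1/2))) holomorphic_on open_strip"
    unfolding P_def by (intro holomorphic_intros)+
  have jets: "jet 0 h = x 0" "jet 1 h = x 1" "jet 2 h = x 2"
    unfolding h_def jet_mult_le_2[OF holE(3,4)] jet_mult_le_2[OF holE(1,2)] jet_exp jet_P jet_gauss
    by (simp_all add: p_def field_simps power2_eq_square)
  show thesis
  proof
    show "F \<in> calderon" by (rule F)
    show "delta n F = x n *\<^sub>C ?u" if "n \<le> 2" for n
    proof -
      have "n = 0 \<or> n = 1 \<or> n = 2" using that by linarith
      then show ?thesis using delta_F[of n] jets by auto
    qed
    show "calderon_norm F \<le> 6 * Q * exp (l / 2)"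
      unfolding calderon_norm_le_iff[OF F]
    proof (intro ballI allI)
      fix j :: nat and t assume j: "j \<in> {0, 1}"
      \<comment> \<open>On edge \<open>j\<close> the function contributes
        \<open>exp (- l * (j - 1/2))\<close> and the block at most \<open>exp (l * j)\<close>; the
        product is \<open>exp (l / 2)\<close> on both edges.\<close>
      have "cmod (edge j h t) \<le> 6 * Q * exp (- l * (real j - 1/2))"
        using norm_h'[of "of_nat j + \<i> * of_real t"] j by (auto simp: edge_def strip_def)
      moreover have "nrm (couple j) ?u \<le> exp (l * real j)"
        using j nrm_sum_unit_seq_0[OF A(1), of \<epsilon>] nrm_sum_unit_seq_1[OF A(1), of \<epsilon>] \<epsilon> expl by auto
      ultimately have "cmod (edge j h t) * nrm (couple j) ?u \<le> 6 * Q * exp (- l * (real j - 1/2)) * exp (l * real j)"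
        using nrm_couple_nonneg[OF u] Q by (intro mult_mono) auto
      also have "\<dots> = 6 * Q * exp (l / 2)"
        by (simp add: exp_add[symmetric] algebra_simps)
      finally show "nrm (couple j) (edge j F t) \<le> 6 * Q * exp (l / 2)"
        unfolding nrm_F[OF j] .
    qed
  qed
qed

section \<open>Reduction to block averages\<close>

text \<open>\<open>S = {}\<close> gives all of \<open>calderon\<close>, so kernels and the full
  space are treated together.\<close>

definition calderon_ker :: "nat set \<Rightarrow> (complex \<Rightarrow> linf) set"
  where "calderon_ker S = {F \<in> calderon. \<forall>c\<in>S. delta c F = 0}"

text \<open>What a bounded linear section leaves behind: the coefficient at \<open>r\<close> depends
  linearly on the finitely supported coefficient at \<open>p\<close>, through the vectors \<eta>.
  Linearity concerns only this coefficient, not the lifting \<open>G\<close>. An upper bound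
  \<open>N\<close> replaces the quotient norm.\<close>

definition diagonal_lift :: "nat set \<Rightarrow> nat \<Rightarrow> nat \<Rightarrow> bool"
  where "diagonal_lift S p r \<longleftrightarrow> (\<exists>B>0. \<exists>\<eta>. \<forall>F\<in>calderon_ker S. \<forall>A \<epsilon> N.
    finite A \<longrightarrow> delta p F = (\<Sum>j\<in>A. \<epsilon> j *\<^sub>C unit_seq j) \<longrightarrow> calderon_norm F \<le> N \<longrightarrow> 0 < N \<longrightarrow>
    (\<exists>G\<in>calderon_ker S. delta p G = delta p F \<and> delta r G = (\<Sum>j\<in>A. \<epsilon> j *\<^sub>C \<eta> j) \<and>
      calderon_norm G \<le> B * N))"

section \<open>Orthogonality of the characters of a cyclic group\<close>

definition root_of_unity :: "nat \<Rightarrow> nat \<Rightarrow> complex"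
  where "root_of_unity k i = exp (2 * of_real pi * \<i> * of_nat i / of_nat k)"

lemma norm_root_of_unity [simp]: "cmod (root_of_unity k i) = 1"
  by (simp add: root_of_unity_def)

lemma cnj_root_of_unity [simp]: "cnj (root_of_unity k i) * root_of_unity k i = 1"
  using complex_norm_square[of "root_of_unity k i"] by (simp add: mult.commute)

text \<open>Distinct indices of a block of length \<open>k\<close> are incongruent modulo
  \<open>k\<close>, wherever the block starts, so the quotient of their roots is a
  \<open>k\<close>-th root of unity other than 1 and its geometric sum vanishes.\<close>

lemma root_of_unity_orthogonal:
  assumes "i \<in> {s..<s + k}" "j \<in> {s..<s + k}"
  shows "(\<Sum>m<k. cnj (root_of_unity k i ^ m) * root_of_unity k j ^ m) = (if i = j then of_nat k else 0)"
proof -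
  have k: "k \<noteq> 0" using assms by auto
  define z where "z = cnj (root_of_unity k i) * root_of_unity k j"
  have sum: "(\<Sum>m<k. cnj (root_of_unity k i ^ m) * root_of_unity k j ^ m) = (\<Sum>m<k. z ^ m)"
    by (simp add: z_def power_mult_distrib)
  have pow: "root_of_unity k i ^ k = 1" for i
    unfolding root_of_unity_def using complex_root_unity[OF k, of i] by simp
  show ?thesis
  proof (cases "i = j")
    case True
    then show ?thesis unfolding sum by (simp add: z_def)
  next
    case False
    have "i mod k \<noteq> j mod k"
    proof
      assume "i mod k = j mod k"
      then have "k dvd (max i j - min i j)"
        by (metis max_def min_def mod_eq_dvd_iff_nat nat_le_linear)
      moreover have "0 < max i j - min i j" "max i j - min i j < k"
        using False assms by (auto simp: max_def min_def)
      ultimately show False using dvd_imp_le by fastforce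
    qed
    then have ne: "root_of_unity k i \<noteq> root_of_unity k j"
      unfolding root_of_unity_def using complex_root_unity_eq[of k i j] k by simp
    have "root_of_unity k i * z = root_of_unity k j"
      using cnj_root_of_unity[of k i] unfolding z_def by (simp add: mult_ac)
    then have "z \<noteq> 1" using ne by auto
    moreover have "z ^ k = 1"
      by (simp add: z_def power_mult_distrib pow complex_cnj_power[symmetric] del: complex_cnj_power)
    ultimately show ?thesis
      unfolding sum using False geometric_sum[of z k] by simp
  qed
qed

text \<open>Averaging over the characters of a cyclic group of order \<open>k\<close> acting on a block of \<open>k\<close>
  coordinates keeps only the diagonal entries of a linear lifting.\<close>

lemma diagonal_lift_average:
  assumes lift: "diagonal_lift S p r" and pr: "p \<le> 2" "r \<le> 2" and S: "\<And>c. c \<in> S \<Longrightarrow> c \<le> 2"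
  obtains C d where "C > 0"
    "\<And>s k Q x. k > 0 \<Longrightarrow> Q > 0 \<Longrightarrow> jet_le (ln (real k)) Q x \<Longrightarrow> x p = 1 \<Longrightarrow> (\<And>c. c \<in> S \<Longrightarrow> x c = 0) \<Longrightarrow>
      \<exists>y. jet_le (ln (real k)) (C * Q) y \<and> y p = 1 \<and> (\<forall>c\<in>S. y c = 0) \<and>
        y r = (\<Sum>i\<in>{s..<s+k}. d i) / of_nat k"
proof -
  from lift obtain B \<eta> where B: "B > 0" and lift: "\<forall>F\<in>calderon_ker S. \<forall>A \<epsilon> N.
    finite A \<longrightarrow> delta p F = (\<Sum>j\<in>A. \<epsilon> j *\<^sub>C unit_seq j) \<longrightarrow> calderon_norm F \<le> N \<longrightarrow> 0 < N \<longrightarrow>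
    (\<exists>G\<in>calderon_ker S. delta p G = delta p F \<and> delta r G = (\<Sum>j\<in>A. \<epsilon> j *\<^sub>C \<eta> j) \<and>
      calderon_norm G \<le> B * N)"
    unfolding diagonal_lift_def by (elim exE conjE)
  define d where "d i = apply_bcontfun (\<eta> i) i" for i
  show thesis
  proof (rule that[of "96 * B" d])
    fix s k :: nat and Q x
    assume k: "k > 0" and Q: "Q > 0" and x: "jet_le (ln (real k)) Q x" "x p = 1" "\<And>c. c \<in> S \<Longrightarrow> x c = 0"
    define A where "A = {s..<s + k}"
    define l where "l = ln (real (card A))"
    have A: "finite A" "A \<noteq> {}" "card A = k" using k by (auto simp: A_def)
    define \<epsilon> where "\<epsilon> m i = root_of_unity k i ^ m" for m i
    have \<epsilon>: "cmod (\<epsilon> m i) \<le> 1" for m i by (simp add: \<epsilon>_def norm_power)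
    define N where "N = 6 * Q * exp (l / 2)"
    have N: "N > 0" using Q by (simp add: N_def)
    have "\<forall>m\<in>{..<k}. \<exists>G. G \<in> calderon_ker S \<and> delta p G = (\<Sum>j\<in>A. \<epsilon> m j *\<^sub>C unit_seq j) \<and>
        delta r G = (\<Sum>j\<in>A. \<epsilon> m j *\<^sub>C \<eta> j) \<and> calderon_norm G \<le> B * N"
    proof
      fix m
      obtain F where F: "F \<in> calderon" "calderon_norm F \<le> N"
        "\<And>n. n \<le> 2 \<Longrightarrow> delta n F = x n *\<^sub>C (\<Sum>j\<in>A. \<epsilon> m j *\<^sub>C unit_seq j)"
        using exists_calderon_jet[of l Q x A "\<epsilon> m"] x(1) A \<epsilon> unfolding l_def N_def by metis
      have "F \<in> calderon_ker S"
        using F(1) F(3)[OF S] x(3) by (simp add: calderon_ker_def)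
      moreover have "delta p F = (\<Sum>j\<in>A. \<epsilon> m j *\<^sub>C unit_seq j)"
        using F(3)[OF pr(1)] x(2) by simp
      ultimately show "\<exists>G. G \<in> calderon_ker S \<and> delta p G = (\<Sum>j\<in>A. \<epsilon> m j *\<^sub>C unit_seq j) \<and>
        delta r G = (\<Sum>j\<in>A. \<epsilon> m j *\<^sub>C \<eta> j) \<and> calderon_norm G \<le> B * N"
        using bspec[OF lift, of F, rule_format, of A "\<epsilon> m" N] A(1) F(2) N by auto
    qed
    from bchoice[OF this] obtain G where G: "\<forall>m\<in>{..<k}. G m \<in> calderon_ker S \<and>
        delta p (G m) = (\<Sum>j\<in>A. \<epsilon> m j *\<^sub>C unit_seq j) \<and>
        delta r (G m) = (\<Sum>j\<in>A. \<epsilon> m j *\<^sub>C \<eta> j) \<and> calderon_norm (G m) \<le> B * N"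
      by (elim exE)
    have G: "G m \<in> calderon_ker S" "delta p (G m) = (\<Sum>j\<in>A. \<epsilon> m j *\<^sub>C unit_seq j)"
      "delta r (G m) = (\<Sum>j\<in>A. \<epsilon> m j *\<^sub>C \<eta> j)" "calderon_norm (G m) \<le> B * N" if "m < k" for m
      using bspec[OF G, of m] that by simp_all
    \<comment> \<open>Pairing with the conjugate character makes the coefficient at \<open>p\<close>
      equal to 1. The off-diagonal terms at \<open>r\<close> disappear only in \<open>z\<close>,
      after averaging over \<open>m\<close>.\<close>
    define y where "y m n = (\<Sum>i\<in>A. cnj (\<epsilon> m i) * apply_bcontfun (delta n (G m)) i) / of_nat (card A)" for m n
    \<comment> \<open>\<open>96 = 16 * 6\<close> collects the constants of
      \<open>calderon_jet_le\<close> and \<open>exists_calderon_jet\<close>, whose factors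
      \<open>exp (- l / 2)\<close> and \<open>exp (l / 2)\<close> cancel.\<close>
    have eq: "16 * (B * N * exp (- l / 2)) = 96 * B * Q"
      by (simp add: N_def exp_minus field_simps)
    have jet: "jet_le l (96 * B * Q) (y m)" if "m < k" for m
      unfolding y_def eq[symmetric] using G(1)[OF that] G(4)[OF that] A B N \<epsilon>
      by (intro calderon_jet_le l_def) (auto simp: calderon_ker_def)
    define z where "z n = (\<Sum>m<k. y m n) / of_nat k" for n
    show "\<exists>y. jet_le (ln (real k)) (96 * B * Q) y \<and> y p = 1 \<and> (\<forall>c\<in>S. y c = 0) \<and>
        y r = (\<Sum>i\<in>{s..<s+k}. d i) / of_nat k"
    proof (intro exI[of _ z] conjI ballI)
      show "jet_le (ln (real k)) (96 * B * Q) z"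
        using jet_le_average[of "{..<k}" l "96 * B * Q" y] jet k
        unfolding z_def l_def A(3) by auto
      have "y m p = 1" if "m < k" for m
      proof -
        have "cnj (\<epsilon> m i) * apply_bcontfun (delta p (G m)) i = 1" if "i \<in> A" for i
          unfolding G(2)[OF \<open>m < k\<close>] apply_sum_unit_seq[OF A(1)] using that
          by (simp add: \<epsilon>_def power_mult_distrib[symmetric])
        then show ?thesis using k by (simp add: y_def A(3))
      qed
      then show "z p = 1" using k by (simp add: z_def)
      show "z c = 0" if "c \<in> S" for c
        using G(1) that by (simp add: z_def y_def calderon_ker_def)
      have "(\<Sum>m<k. \<Sum>i\<in>A. cnj (\<epsilon> m i) * apply_bcontfun (delta r (G m)) i)
        = (\<Sum>m<k. \<Sum>i\<in>A. \<Sum>j\<in>A. cnj (\<epsilon> m i) * \<epsilon> m j * apply_bcontfun (\<eta> j) i)"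
        by (intro sum.cong refl) (simp add: G(3) apply_sum_bcontfun sum_distrib_left mult.assoc)
      also have "\<dots> = (\<Sum>i\<in>A. \<Sum>m<k. \<Sum>j\<in>A. cnj (\<epsilon> m i) * \<epsilon> m j * apply_bcontfun (\<eta> j) i)"
        by (rule sum.swap)
      also have "\<dots> = (\<Sum>i\<in>A. \<Sum>j\<in>A. \<Sum>m<k. cnj (\<epsilon> m i) * \<epsilon> m j * apply_bcontfun (\<eta> j) i)"
        by (intro sum.cong refl sum.swap)
      also have "\<dots> = (\<Sum>i\<in>A. \<Sum>j\<in>A. (\<Sum>m<k. cnj (\<epsilon> m i) * \<epsilon> m j) * apply_bcontfun (\<eta> j) i)"
        by (simp only: sum_distrib_right)
      also have "\<dots> = (\<Sum>i\<in>A. \<Sum>j\<in>A. (if i = j then of_nat k else 0) * apply_bcontfun (\<eta> j) i)"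
        unfolding \<epsilon>_def A_def by (intro sum.cong refl) (simp only: root_of_unity_orthogonal)
      also have "\<dots> = of_nat k * (\<Sum>i\<in>A. d i)"
        by (simp add: if_distrib[where f = "\<lambda>x. x * _"] A(1) d_def sum_distrib_left cong: if_cong)
      finally have "(\<Sum>m<k. \<Sum>i\<in>A. cnj (\<epsilon> m i) * apply_bcontfun (delta r (G m)) i) = of_nat k * (\<Sum>i\<in>A. d i)" .
      then show "z r = (\<Sum>i\<in>{s..<s+k}. d i) / of_nat k"
        unfolding z_def y_def using k A by (simp add: sum_divide_distrib[symmetric] A_def)
    qed
  qed (use B in simp)
qed

text \<open>If the averages over all blocks of length \<open>k\<close> were \<open>\<kappa> / W k\<close> up to a factor \<open>1 + O(1 / ln k)\<close>,
  then so would be the average over \<open>k\<close> consecutive blocks of length \<open>k\<close>, a block of length \<open>k\<^sup>2\<close>.\<close>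

lemma block_average_contradiction:
  fixes d :: "nat \<Rightarrow> complex" and W :: "real \<Rightarrow> real"
  assumes W: "\<And>l. l \<ge> 1 \<Longrightarrow> W (2 * l) = \<tau> * W l" and \<tau>: "\<tau> \<noteq> 1" and \<kappa>: "\<kappa> \<noteq> 0"
    and avg: "\<And>k s. k \<ge> 3 \<Longrightarrow>
      cmod ((\<Sum>i\<in>{s..<s+k}. d i) / of_nat k * of_real (W (ln (real k))) - of_real \<kappa>) \<le> C / ln (real k)"
  shows False
proof -
  have le: "\<bar>\<kappa>\<bar> * \<bar>1 - \<tau>\<bar> \<le> (\<bar>\<tau>\<bar> + 1) * \<bar>C\<bar> / ln (real k)" if k: "k \<ge> 3" for k
  proof -
    \<comment> \<open>Three exceeds Euler's number, so \<open>k \<ge> 3\<close> puts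
      \<open>ln k\<close> into the range where \<open>W\<close> scales.\<close>
    have "exp 1 \<le> real k" using exp_le k by linarith
    then have l1: "ln (real k) \<ge> 1" using k by (subst ln_ge_iff) auto
    define l where "l = ln (real k)"
    have l2: "ln (real (k * k)) = 2 * l" using k by (simp add: l_def ln_mult)
    define X where "X = (\<Sum>i<k*k. d i) / of_nat (k * k)"
    have "X = (\<Sum>m<k. (\<Sum>i\<in>{m*k..<m*k+k}. d i) / of_nat k) / of_nat k"
      unfolding X_def sum.nat_group[symmetric] by (simp add: sum_divide_distrib[symmetric])
    then have X: "X * of_real (W l) - of_real \<kappa> = (\<Sum>m<k. (\<Sum>i\<in>{m*k..<m*k+k}. d i) / of_nat k * of_real (W l) - of_real \<kappa>) / of_nat k"
      using k by (simp add: sum_subtractf sum_distrib_right diff_divide_distrib)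
    have sum: "cmod (\<Sum>m<k. (\<Sum>i\<in>{m*k..<m*k+k}. d i) / of_nat k * of_real (W l) - of_real \<kappa>) \<le> of_nat (card {..<k}) * (C / l)"
      using avg[OF k] unfolding l_def by (intro sum_norm_bound) auto
    have "cmod (S / of_nat k) \<le> E" if "cmod S \<le> of_nat (card {..<k}) * E" for S E
      using that k by (simp add: norm_divide pos_divide_le_eq mult.commute)
    from this[OF sum] have 1: "cmod (X * of_real (W l) - of_real \<kappa>) \<le> C / l"
      unfolding X .
    have "k * k \<ge> 3" using k mult_le_mono[of 3 k 1 k] by simp
    from avg[OF this, of 0] have 2: "cmod (X * of_real (\<tau> * W l) - of_real \<kappa>) \<le> C / (2 * l)"
      using W[of l] l1 unfolding l2 X_def by (simp add: l_def atLeast0LessThan)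
    have l: "l > 0" using l1 by (simp add: l_def)
    have "C / l \<le> \<bar>C\<bar> / l" "C / (2 * l) \<le> \<bar>C\<bar> / l"
      using l by (auto simp: divide_simps)
    note bounds = order_trans[OF 1 this(1)] order_trans[OF 2 this(2)]
    have "\<bar>\<kappa>\<bar> * \<bar>1 - \<tau>\<bar> = cmod (of_real (\<kappa> * (1 - \<tau>)))"
      by (simp only: norm_of_real abs_mult)
    \<comment> \<open>The average \<open>X\<close> is weighted with \<open>W l\<close> when seen as
      \<open>k\<close> blocks and with \<open>\<tau> * W l\<close> when seen as one block; this
      combination eliminates \<open>X\<close>.\<close>
    also have "of_real (\<kappa> * (1 - \<tau>)) = of_real \<tau> * (X * of_real (W l) - of_real \<kappa>) - (X * of_real (\<tau> * W l) - of_real \<kappa>)"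
      by (simp add: algebra_simps)
    also have "cmod \<dots> \<le> \<bar>\<tau>\<bar> * (\<bar>C\<bar> / l) + \<bar>C\<bar> / l"
      by (rule order_trans[OF norm_triangle_ineq4])
        (intro add_mono, simp_all only: norm_mult norm_of_real mult_left_mono[OF bounds(1)] bounds abs_ge_zero)
    finally show ?thesis by (simp add: l_def distrib_right add_divide_distrib)
  qed
  have "(\<lambda>k. (\<bar>\<tau>\<bar> + 1) * \<bar>C\<bar> / ln (real k)) \<longlonglongrightarrow> 0"
    by real_asymp
  then have "\<bar>\<kappa>\<bar> * \<bar>1 - \<tau>\<bar> \<le> 0"
    by (rule LIMSEQ_le_const) (use le in blast)
  then show False using \<tau> \<kappa> by (simp add: mult_le_0_iff)
qed

section \<open>Asymptotics of the diagonal\<close>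

text \<open>Averaging turns the test jet \<open>x l\<close> into a jet \<open>y\<close> obeying
  \<open>jet_le\<close> with \<open>C * Q l\<close>, and the identity \<open>id\<close> then bounds
  the error of \<open>y r * W l\<close> against \<kappa> by \<open>C * 10 / l\<close>. As
  \<open>y r\<close> is a block average, \<open>block_average_contradiction\<close> applies. The
  constant 10 exceeds all those arising below, which are at most 8.\<close>

lemma no_diagonal_lift:
  fixes x :: "real \<Rightarrow> nat \<Rightarrow> complex" and W Q \<alpha> \<beta> :: "real \<Rightarrow> real"
  assumes pr: "p \<le> 2" "r \<le> 2" and S: "\<And>c. c \<in> S \<Longrightarrow> c \<le> 2"
    and W: "\<And>l. l \<ge> 1 \<Longrightarrow> W (2 * l) = \<tau> * W l" "\<tau> \<noteq> 1" "\<kappa> \<noteq> 0"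
    and x: "\<And>l. l \<ge> 1 \<Longrightarrow> jet_le l (Q l) (x l)" "\<And>l. l \<ge> 1 \<Longrightarrow> x l p = 1" "\<And>l c. l \<ge> 1 \<Longrightarrow> c \<in> S \<Longrightarrow> x l c = 0"
    and Q: "\<And>l. l \<ge> 1 \<Longrightarrow> Q l > 0"
    and id: "\<And>l (y :: nat \<Rightarrow> complex). l \<ge> 1 \<Longrightarrow> y p = 1 \<Longrightarrow> (\<And>c. c \<in> S \<Longrightarrow> y c = 0) \<Longrightarrow>
      y r * of_real (W l) - of_real \<kappa> =
        of_real (\<alpha> l) * (y 1 + l * y 0) + of_real (\<beta> l) * (y 2 + l * y 1 + of_real (l\<^sup>2 / 2) * y 0)"
    and small: "\<And>l. l \<ge> 1 \<Longrightarrow> (\<bar>\<alpha> l\<bar> + \<bar>\<beta> l\<bar>) * Q l \<le> 10 / l"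
  shows "\<not> diagonal_lift S p r"
proof
  assume "diagonal_lift S p r"
  then obtain C d where C: "C > 0" and avg: "\<And>s k Q x. k > 0 \<Longrightarrow> Q > 0 \<Longrightarrow> jet_le (ln (real k)) Q x \<Longrightarrow> x p = 1 \<Longrightarrow> (\<And>c. c \<in> S \<Longrightarrow> x c = 0) \<Longrightarrow>
      \<exists>y. jet_le (ln (real k)) (C * Q) y \<and> y p = 1 \<and> (\<forall>c\<in>S. y c = 0) \<and>
        y r = (\<Sum>i\<in>{s..<s+k}. d i) / of_nat k"
    by (rule diagonal_lift_average[OF _ pr S]) (assumption | blast)+
  show False
  proof (rule block_average_contradiction[where W = W and C = "C * 10" and d = d, OF W])
    fix k s :: nat assume k: "k \<ge> 3"
    define l where "l = ln (real k)"
    have "exp 1 \<le> real k" using exp_le k by linarith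
    then have l: "l \<ge> 1" unfolding l_def using k by (subst ln_ge_iff) auto
    obtain y where y: "jet_le l (C * Q l) y" "y p = 1" "\<forall>c\<in>S. y c = 0"
      "y r = (\<Sum>i\<in>{s..<s+k}. d i) / of_nat k"
      using avg[of k "Q l" "x l" s] k l Q x by (auto simp: l_def)
    have eq: "y r * of_real (W l) - of_real \<kappa> =
        of_real (\<alpha> l) * (y 1 + l * y 0) + of_real (\<beta> l) * (y 2 + l * y 1 + of_real (l\<^sup>2 / 2) * y 0)"
      by (rule id[of l y, OF l y(2)]) (use y(3) in blast)
    have "cmod (y r * of_real (W l) - of_real \<kappa>) \<le> \<bar>\<alpha> l\<bar> * cmod (y 1 + l * y 0) + \<bar>\<beta> l\<bar> * cmod (y 2 + l * y 1 + of_real (l\<^sup>2 / 2) * y 0)"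
      unfolding eq by (rule order_trans[OF norm_triangle_ineq]) (simp only: norm_mult norm_of_real order_refl)
    also have "\<dots> \<le> \<bar>\<alpha> l\<bar> * (C * Q l) + \<bar>\<beta> l\<bar> * (C * Q l)"
      using y(1) unfolding jet_le_def by (intro add_mono mult_left_mono) auto
    also have "\<dots> = C * ((\<bar>\<alpha> l\<bar> + \<bar>\<beta> l\<bar>) * Q l)" by (simp add: algebra_simps)
    also have "\<dots> \<le> C * (10 / l)" using small[OF l] C by (intro mult_left_mono) auto
    finally show "cmod ((\<Sum>i\<in>{s..<s+k}. d i) / of_nat k * of_real (W (ln (real k))) - of_real \<kappa>) \<le> C * 10 / ln (real k)"
      unfolding y(4) l_def by simp
  qed
qed

definition real_jet :: "real \<Rightarrow> real \<Rightarrow> real \<Rightarrow> nat \<Rightarrow> complex"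
  where "real_jet a b c n = of_real (if n = 0 then a else if n = 1 then b else c)"

text \<open>Replaces complex moduli by absolute values of reals, so that the cases below reduce to
  field arithmetic.\<close>

lemma jet_le_real_jet:
  "jet_le l Q (real_jet a b c) \<longleftrightarrow> \<bar>a\<bar> \<le> Q \<and> \<bar>b + l * a\<bar> \<le> Q \<and> \<bar>c + l * b + l\<^sup>2 / 2 * a\<bar> \<le> Q"
proof -
  have "cmod (of_real b + of_real l * of_real a) = \<bar>b + l * a\<bar>"
    "cmod (of_real c + of_real l * of_real b + of_real (l\<^sup>2 / 2) * of_real a) = \<bar>c + l * b + l\<^sup>2 / 2 * a\<bar>"
    by (simp_all only: of_real_mult[symmetric] of_real_add[symmetric] norm_of_real)
  then show ?thesis by (simp add: jet_le_def real_jet_def)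
qed

text \<open>In each case \<open>W\<close> and \<open>\<kappa>\<close> describe the forced asymptotics \<open>\<kappa> / W l\<close> of the block averages of
  the diagonal, and the test jet is chosen such that its multiple by \<open>exp (l * (z - 1/2))\<close> has as
  small coefficients as possible.\<close>

lemma no_diagonal_lift_kernel:
  assumes "distinct [a, b, c]" "{a, b, c} = {2, 1, 0 :: nat}"
  shows "\<not> diagonal_lift {c} b a"
proof -
  note rules = jet_le_real_jet real_jet_def power2_eq_square
  \<comment> \<open>Here \<open>y 0 = 0\<close> and \<open>y 1 = 1\<close>, so the last entry of
    \<open>jet_le\<close> reads \<open>y 2 + l\<close> and forces
    \<open>y 2 = - l + O(1)\<close>.\<close>
  have "\<not> diagonal_lift {0} 1 2"
    by (rule no_diagonal_lift[where W = "\<lambda>l. 1 / l" and \<kappa> = "- 1" and \<tau> = "1 / 2"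
          and x = "\<lambda>l. real_jet 0 1 (- l)" and Q = "\<lambda>l. 1" and \<alpha> = "\<lambda>l. 0" and \<beta> = "\<lambda>l. 1 / l"])
      (simp_all add: rules, (simp_all add: field_simps)?)
  moreover have "\<not> diagonal_lift {0} 2 1"
    by (rule no_diagonal_lift[where W = "\<lambda>l. l" and \<kappa> = "- 1" and \<tau> = 2
          and x = "\<lambda>l. real_jet 0 (- 1 / l) 1" and Q = "\<lambda>l. 1 / l" and \<alpha> = "\<lambda>l. 0" and \<beta> = "\<lambda>l. 1"])
      (simp_all add: rules, (simp_all add: field_simps)?)
  \<comment> \<open>With \<open>y 0 = 1\<close> and \<open>y 1 = 0\<close> the middle entry of
    \<open>jet_le\<close> is \<open>l\<close>, so no smaller \<open>Q\<close> is possible.\<close>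
  moreover have "\<not> diagonal_lift {1} 0 2"
    by (rule no_diagonal_lift[where W = "\<lambda>l. 1 / l\<^sup>2" and \<kappa> = "- 1 / 2" and \<tau> = "1 / 4"
          and x = "\<lambda>l. real_jet 1 0 (- l\<^sup>2 / 2)" and Q = "\<lambda>l. l" and \<alpha> = "\<lambda>l. 0" and \<beta> = "\<lambda>l. 1 / l\<^sup>2"])
      (simp_all add: rules, (simp_all add: field_simps)?)
  moreover have "\<not> diagonal_lift {1} 2 0"
    by (rule no_diagonal_lift[where W = "\<lambda>l. l\<^sup>2" and \<kappa> = "- 2" and \<tau> = 4
          and x = "\<lambda>l. real_jet (- 2 / l\<^sup>2) 0 1" and Q = "\<lambda>l. 2 / l" and \<alpha> = "\<lambda>l. 0" and \<beta> = "\<lambda>l. 2"])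
      (simp_all add: rules, (simp_all add: field_simps)?)
  moreover have "\<not> diagonal_lift {2} 0 1"
    by (rule no_diagonal_lift[where W = "\<lambda>l. 1 / l" and \<kappa> = "- 1 / 2" and \<tau> = "1 / 2"
          and x = "\<lambda>l. real_jet 1 (- l / 2) 0" and Q = "\<lambda>l. l" and \<alpha> = "\<lambda>l. 0" and \<beta> = "\<lambda>l. 1 / l\<^sup>2"])
      (simp_all add: rules, (simp_all add: field_simps)?)
  moreover have "\<not> diagonal_lift {2} 1 0"
    by (rule no_diagonal_lift[where W = "\<lambda>l. l" and \<kappa> = "- 2" and \<tau> = 2
          and x = "\<lambda>l. real_jet (- 2 / l) 1 0" and Q = "\<lambda>l. 2" and \<alpha> = "\<lambda>l. 0" and \<beta> = "\<lambda>l. 2 / l"])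
      (simp_all add: rules, (simp_all add: field_simps)?)
  moreover have "a \<in> {2, 1, 0}" "b \<in> {2, 1, 0}" "c \<in> {2, 1, 0}"
    using assms(2) by blast+
  then have "a = 2 \<and> b = 1 \<and> c = 0 \<or> a = 1 \<and> b = 2 \<and> c = 0 \<or> a = 2 \<and> b = 0 \<and> c = 1 \<or>
    a = 0 \<and> b = 2 \<and> c = 1 \<or> a = 1 \<and> b = 0 \<and> c = 2 \<or> a = 0 \<and> b = 1 \<and> c = 2"
    using assms(1) by auto
  ultimately show ?thesis by blast
qed

text \<open>With no coefficient forced to vanish, every test jet is the multiple of the jet
  \<open>1, - l, l^2 / 2\<close> of \<open>exp (- l * (z - 1/2))\<close> whose entry at
  \<open>c\<close> is 1. Its product with \<open>exp (l * (z - 1/2))\<close> is constant, so only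
  the first entry of \<open>jet_le\<close> contributes.\<close>

lemma no_diagonal_lift_full:
  assumes "b \<noteq> c" "b \<le> 2" "c \<le> 2"
  shows "\<not> diagonal_lift {} c b"
proof -
  note rules = jet_le_real_jet real_jet_def power2_eq_square
  have "\<not> diagonal_lift {} 0 1"
    by (rule no_diagonal_lift[where W = "\<lambda>l. 1 / l" and \<kappa> = "- 1" and \<tau> = "1 / 2"
          and x = "\<lambda>l. real_jet 1 (- l) (l\<^sup>2 / 2)" and Q = "\<lambda>l. 1" and \<alpha> = "\<lambda>l. 1 / l" and \<beta> = "\<lambda>l. 0"])
      (simp_all add: rules, (simp_all add: field_simps)?)
  \<comment> \<open>The coefficient \<open>y 1\<close> is neither prescribed nor sought; \<alpha>
    and \<beta> are chosen such that it cancels. The remaining cases with \<beta> nonzero work in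
    the same way.\<close>
  moreover have "\<not> diagonal_lift {} 0 2"
    by (rule no_diagonal_lift[where W = "\<lambda>l. 1 / l\<^sup>2" and \<kappa> = "1 / 2" and \<tau> = "1 / 4"
          and x = "\<lambda>l. real_jet 1 (- l) (l\<^sup>2 / 2)" and Q = "\<lambda>l. 1" and \<alpha> = "\<lambda>l. - 1 / l" and \<beta> = "\<lambda>l. 1 / l\<^sup>2"])
      (simp_all add: rules, (simp_all add: field_simps)?)
  moreover have "\<not> diagonal_lift {} 1 0"
    by (rule no_diagonal_lift[where W = "\<lambda>l. l" and \<kappa> = "- 1" and \<tau> = 2
          and x = "\<lambda>l. real_jet (- 1 / l) 1 (- l / 2)" and Q = "\<lambda>l. 1 / l" and \<alpha> = "\<lambda>l. 1" and \<beta> = "\<lambda>l. 0"])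
      (simp_all add: rules, (simp_all add: field_simps)?)
  moreover have "\<not> diagonal_lift {} 1 2"
    by (rule no_diagonal_lift[where W = "\<lambda>l. 1 / l" and \<kappa> = "- 1 / 2" and \<tau> = "1 / 2"
          and x = "\<lambda>l. real_jet (- 1 / l) 1 (- l / 2)" and Q = "\<lambda>l. 1 / l" and \<alpha> = "\<lambda>l. - 1 / 2" and \<beta> = "\<lambda>l. 1 / l"])
      (simp_all add: rules, (simp_all add: field_simps)?)
  moreover have "\<not> diagonal_lift {} 2 0"
    by (rule no_diagonal_lift[where W = "\<lambda>l. l\<^sup>2" and \<kappa> = 2 and \<tau> = 4
          and x = "\<lambda>l. real_jet (2 / l\<^sup>2) (- 2 / l) 1" and Q = "\<lambda>l. 2 / l\<^sup>2" and \<alpha> = "\<lambda>l. 2 * l" and \<beta> = "\<lambda>l. - 2"])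
      (simp_all add: rules, (simp_all add: field_simps)?)
  moreover have "\<not> diagonal_lift {} 2 1"
    by (rule no_diagonal_lift[where W = "\<lambda>l. l" and \<kappa> = "- 2" and \<tau> = 2
          and x = "\<lambda>l. real_jet (2 / l\<^sup>2) (- 2 / l) 1" and Q = "\<lambda>l. 2 / l\<^sup>2" and \<alpha> = "\<lambda>l. - l" and \<beta> = "\<lambda>l. 2"])
      (simp_all add: rules, (simp_all add: field_simps)?)
  moreover have "b = 0 \<or> b = 1 \<or> b = 2" "c = 0 \<or> c = 1 \<or> c = 2"
    using assms by linarith+
  ultimately show ?thesis using assms(1) by auto
qed

section \<open>Splittings and diagonal liftings\<close>

lemma calderon_ker_lin:
  assumes "F \<in> calderon_ker S" "G \<in> calderon_ker S"
  shows "(\<lambda>z. F z + c *\<^sub>C G z) \<in> calderon_ker S"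
  using assms by (auto simp: calderon_ker_def calderon_lin delta_lin)

lemma exists_unit_jet:
  assumes "p \<le> 2" "p \<notin> S" "\<And>c. c \<in> S \<Longrightarrow> c \<le> 2"
  shows "\<exists>F\<in>calderon_ker S. delta p F = unit_seq j"
proof -
  define x :: "nat \<Rightarrow> complex" where "x n = (if n = p then 1 else 0)" for n
  \<comment> \<open>A block of a single coordinate has \<open>l = ln 1 = 0\<close>, so the three
    entries of \<open>jet_le\<close> are the coefficients themselves.\<close>
  have "jet_le 0 1 x" by (simp add: jet_le_def x_def)
  then obtain F where F: "F \<in> calderon" "\<And>n. n \<le> 2 \<Longrightarrow> delta n F = x n *\<^sub>C (\<Sum>i\<in>{j}. 1 *\<^sub>C unit_seq i)"
    by (rule exists_calderon_jet[where A = "{j}" and \<epsilon> = "\<lambda>_. 1"]) simp_all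
  moreover have "delta c F = 0" if "c \<in> S" for c
    using F(2)[OF assms(3)[OF that]] that assms(2) by (auto simp: x_def)
  ultimately show ?thesis
    using F(2)[OF assms(1)] by (auto simp: calderon_ker_def x_def intro!: bexI[of _ F])
qed

section \<open>Quotient norms and their representatives\<close>

lemma bdd_below_calderon_norm: "K \<subseteq> calderon \<Longrightarrow> bdd_below (calderon_norm ` K)"
  by (auto intro!: bdd_belowI[of _ 0] calderon_norm_nonneg)

lemma quotient_nrm_le:
  assumes "K \<subseteq> calderon" "F \<in> K"
  shows "nrm (quotient_space T K) (T F) \<le> calderon_norm F"
  unfolding quotient_space_def nspace.select_convs
  using assms by (intro cINF_lower bdd_below_calderon_norm) auto

text \<open>An infimum guarantees representatives only below numbers strictly above it.\<close>

lemma quotient_nrm_less: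
  assumes "K \<subseteq> calderon" "z \<in> T ` K" "nrm (quotient_space T K) z < N"
  obtains F where "F \<in> K" "T F = z" "calderon_norm F < N"
proof -
  have "{F \<in> K. T F = z} \<noteq> {}" "bdd_below (calderon_norm ` {F \<in> K. T F = z})"
    using assms by (auto intro!: bdd_below_calderon_norm)
  from cINF_less_iff[OF this] show thesis
    using assms(3) that unfolding quotient_space_def by auto
qed

text \<open>For a bounded projection \<open>P\<close> onto \<open>W\<close>, the map
  \<open>\<sigma> = id - P\<close> vanishes on \<open>W\<close>, so for \<open>F\<close> in
  \<open>calderon_ker S\<close> the value \<open>\<rho> (\<sigma> (T F))\<close> depends only on
  \<open>delta p F\<close>. Subtracting from \<open>F\<close> a representative of
  \<open>P (T F)\<close> gives the lifting. If \<open>R\<close> is smaller than \<open>S\<close>,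
  the section is in effect restricted to \<open>calderon_ker S\<close>.\<close>

lemma diagonal_lift_if_complemented:
  fixes T :: "(complex \<Rightarrow> linf) \<Rightarrow> 'z::complex_normed_vector" and \<rho> :: "'z \<Rightarrow> linf"
  assumes comp: "complemented (quotient_space T (calderon_ker R)) W"
    and RS: "R \<subseteq> S"
    and T_lin: "\<And>F G c. F \<in> calderon \<Longrightarrow> G \<in> calderon \<Longrightarrow> T (\<lambda>z. F z + c *\<^sub>C G z) = T F + c *\<^sub>C T G"
    and \<rho>_lin: "\<And>u v c. \<rho> (u + c *\<^sub>C v) = \<rho> u + c *\<^sub>C \<rho> v"
    and \<rho>_T: "\<And>F. \<rho> (T F) = delta r F"
    and W: "\<And>D. D \<in> calderon_ker R \<Longrightarrow> T D \<in> W \<longleftrightarrow> D \<in> calderon_ker S \<and> delta p D = 0"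
    and E: "\<And>j. \<exists>E\<in>calderon_ker S. delta p E = unit_seq j"
  shows "diagonal_lift S p r"
proof -
  let ?K = "calderon_ker R"
  let ?Z = "quotient_space T ?K"
  have K: "?K \<subseteq> calderon" "calderon_ker S \<subseteq> ?K" using RS by (auto simp: calderon_ker_def)
  have S_calderon: "F \<in> calderon" if "F \<in> calderon_ker S" for F using that K by blast
  have pts: "pts ?Z = T ` ?K" by (simp add: quotient_space_def)
  obtain P where P: "bounded_op ?Z ?Z P" "P ` pts ?Z = W" "\<And>w. w \<in> W \<Longrightarrow> P w = w"
    using comp unfolding complemented_def by blast
  obtain B where B: "\<And>z. z \<in> pts ?Z \<Longrightarrow> nrm ?Z (P z) \<le> B * nrm ?Z z"
    using P(1) unfolding bounded_op_def by blast
  \<comment> \<open>The multiple by \<open>c\<close> is written as \<open>F + (c - 1) F\<close>,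
    since closure and linearity are available for this form of combination.\<close>
  have scale: "c *\<^sub>C v \<in> pts ?Z" if v: "v \<in> pts ?Z" for c v
  proof -
    obtain F where F: "F \<in> ?K" "v = T F" using v pts by blast
    then have "c *\<^sub>C v = T (\<lambda>z. F z + (c - 1) *\<^sub>C F z)"
      using K T_lin[of F F "c - 1"] scaleC_add_left[of 1 "c - 1" "T F"] by auto
    then show ?thesis using calderon_ker_lin[OF F(1) F(1)] pts by auto
  qed
  define \<sigma> where "\<sigma> v = v - P v" for v
  have P_lin: "P (u + c *\<^sub>C v) = P u + c *\<^sub>C P v" if "u \<in> pts ?Z" "v \<in> pts ?Z" for u v c
    using P(1) that scale[OF that(2), of c] unfolding bounded_op_def by simp
  have \<sigma>_lin: "\<sigma> (u + c *\<^sub>C v) = \<sigma> u + c *\<^sub>C \<sigma> v" if "u \<in> pts ?Z" "v \<in> pts ?Z" for u v c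
  proof -
    have "c *\<^sub>C (v - P v) = c *\<^sub>C v - c *\<^sub>C P v"
      using scaleC_add_right[of c "v - P v" "P v"] by (simp add: eq_diff_eq)
    then show ?thesis unfolding \<sigma>_def P_lin[OF that] by simp
  qed
  have "\<forall>j. \<exists>G. G \<in> calderon_ker S \<and> delta p G = unit_seq j" using E by blast
  from choice[OF this] obtain e where e: "\<And>j. e j \<in> calderon_ker S" "\<And>j. delta p (e j) = unit_seq j"
    by blast
  define \<eta> where "\<eta> j = \<rho> (\<sigma> (T (e j)))" for j
  have comb: "\<exists>H\<in>calderon_ker S. delta p H = (\<Sum>j\<in>A. \<epsilon> j *\<^sub>C unit_seq j) \<and> \<rho> (\<sigma> (T H)) = (\<Sum>j\<in>A. \<epsilon> j *\<^sub>C \<eta> j)"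
    if "finite A" for A and \<epsilon> :: "nat \<Rightarrow> complex"
    using that
  proof (induction A rule: finite_induct)
    case empty
    \<comment> \<open>The zero function is produced as a difference of an element with
      itself.\<close>
    let ?H = "\<lambda>z. e 0 z + (-1) *\<^sub>C e 0 z"
    have H: "?H \<in> calderon_ker S" by (rule calderon_ker_lin[OF e(1) e(1)])
    have T: "T (e 0) \<in> pts ?Z" using e(1)[of 0] K pts by blast
    have "T ?H = T (e 0) + (-1) *\<^sub>C T (e 0)" "delta p ?H = delta p (e 0) + (-1) *\<^sub>C delta p (e 0)"
      using T_lin[of "e 0" "e 0" "-1"] delta_lin[of "e 0" "e 0" p "-1"] S_calderon[OF e(1)] by auto
    then have "\<rho> (\<sigma> (T ?H)) = 0" "delta p ?H = 0"
      by (simp_all only: \<sigma>_lin[OF T T] \<rho>_lin) (simp_all add: scaleC_minus_one)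
    then show ?case using H by auto
  next
    case (insert a A)
    then obtain H where H: "H \<in> calderon_ker S" "delta p H = (\<Sum>j\<in>A. \<epsilon> j *\<^sub>C unit_seq j)"
      "\<rho> (\<sigma> (T H)) = (\<Sum>j\<in>A. \<epsilon> j *\<^sub>C \<eta> j)" by blast
    let ?H = "\<lambda>z. H z + \<epsilon> a *\<^sub>C e a z"
    have "T H \<in> pts ?Z" "T (e a) \<in> pts ?Z" using H(1) e(1)[of a] K pts by blast+
    moreover have "T ?H = T H + \<epsilon> a *\<^sub>C T (e a)"
      by (intro T_lin S_calderon H(1) e(1))
    ultimately have "\<rho> (\<sigma> (T ?H)) = \<rho> (\<sigma> (T H)) + \<epsilon> a *\<^sub>C \<eta> a"
      by (simp only: \<sigma>_lin \<rho>_lin \<eta>_def)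
    moreover have "delta p ?H = delta p H + \<epsilon> a *\<^sub>C unit_seq a"
      by (simp only: delta_lin S_calderon H(1) e)
    moreover have "?H \<in> calderon_ker S" by (rule calderon_ker_lin[OF H(1) e(1)])
    ultimately show ?case
      using insert.hyps by (intro bexI[of _ ?H]) (simp_all add: H add.commute)
  qed
  show ?thesis
    unfolding diagonal_lift_def
  \<comment> \<open>\<open>F\<close> contributes \<open>N\<close>, and the representative of
    \<open>P (T F)\<close> contributes \<open>(\<bar>B\<bar> + 1) * N\<close>, where the summand 1
    provides the strict inequality above the quotient norm.\<close>
  proof (intro exI[of _ "\<bar>B\<bar> + 2"] conjI exI[of _ \<eta>] ballI allI impI)
    fix F A \<epsilon> N
    assume F: "F \<in> calderon_ker S" and A: "finite A" and pF: "delta p F = (\<Sum>j\<in>A. \<epsilon> j *\<^sub>C unit_seq j)"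
      and N: "calderon_norm F \<le> N" "0 < N"
    obtain H where H: "H \<in> calderon_ker S" "delta p H = (\<Sum>j\<in>A. \<epsilon> j *\<^sub>C unit_seq j)"
      "\<rho> (\<sigma> (T H)) = (\<Sum>j\<in>A. \<epsilon> j *\<^sub>C \<eta> j)" using comb[OF A] by blast
    \<comment> \<open>\<open>F\<close> and \<open>H\<close> have the same coefficient at
      \<open>p\<close>, so their difference is mapped into \<open>W\<close> and annihilated by
      \<sigma>; the value known for \<open>H\<close> passes to \<open>F\<close>.\<close>
    let ?D = "\<lambda>z. F z + (-1) *\<^sub>C H z"
    have D: "?D \<in> calderon_ker S" by (rule calderon_ker_lin[OF F H(1)])
    have "delta p ?D = 0"
      using delta_lin[OF S_calderon[OF F] S_calderon[OF H(1)], of p "-1"] pF H(2) by (simp add: scaleC_minus_one)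
    then have "T ?D \<in> W" using W[of ?D] D K by blast
    then have "\<sigma> (T ?D) = 0" using P(3) by (simp add: \<sigma>_def)
    moreover have pts_T: "T F \<in> pts ?Z" "T H \<in> pts ?Z" using F H(1) K pts by blast+
    moreover have "T ?D = T F + (-1) *\<^sub>C T H" by (rule T_lin[OF S_calderon[OF F] S_calderon[OF H(1)]])
    ultimately have "\<sigma> (T F) + (-1) *\<^sub>C \<sigma> (T H) = 0"
      by (simp only: \<sigma>_lin)
    then have \<sigma>F: "\<rho> (\<sigma> (T F)) = (\<Sum>j\<in>A. \<epsilon> j *\<^sub>C \<eta> j)"
      using H(3) by (simp add: scaleC_minus_one)
    have "P (T F) \<in> W" using P(2) pts_T(1) by blast
    have "P (T F) \<in> T ` ?K" using P(1) pts_T(1) unfolding bounded_op_def pts by blast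
    moreover have "nrm ?Z (P (T F)) < (\<bar>B\<bar> + 1) * N"
    proof -
      have "0 \<le> nrm ?Z (T F)"
        unfolding quotient_space_def nspace.select_convs
        using F K by (intro cINF_greatest calderon_norm_nonneg) auto
      moreover have "nrm ?Z (T F) \<le> N"
        using quotient_nrm_le[OF K(1), of F T] F K(2) N(1) by fastforce
      ultimately have "B * nrm ?Z (T F) \<le> \<bar>B\<bar> * N"
        by (intro mult_mono) auto
      then show ?thesis using B[OF pts_T(1)] N(2) by (simp add: distrib_right)
    qed
    ultimately obtain G where G: "G \<in> ?K" "T G = P (T F)" "calderon_norm G < (\<bar>B\<bar> + 1) * N"
      by (rule quotient_nrm_less[OF K(1)])
    then have GS: "G \<in> calderon_ker S" "delta p G = 0"
      using W[OF G(1)] \<open>P (T F) \<in> W\<close> by simp_all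
    let ?G = "\<lambda>z. F z + (-1) *\<^sub>C G z"
    show "\<exists>G\<in>calderon_ker S. delta p G = delta p F \<and> delta r G = (\<Sum>j\<in>A. \<epsilon> j *\<^sub>C \<eta> j) \<and>
      calderon_norm G \<le> (\<bar>B\<bar> + 2) * N"
    proof (intro bexI[of _ ?G] conjI)
      note lin = S_calderon[OF F] S_calderon[OF GS(1)]
      show "delta p ?G = delta p F" using delta_lin[OF lin, of p "-1"] GS(2) by simp
      have "T ?G = \<sigma> (T F)" using T_lin[OF lin, of "-1"] G(2) by (simp add: \<sigma>_def scaleC_minus_one)
      then show "delta r ?G = (\<Sum>j\<in>A. \<epsilon> j *\<^sub>C \<eta> j)" using \<rho>_T[of ?G] \<sigma>F by simp
      show "calderon_norm ?G \<le> (\<bar>B\<bar> + 2) * N"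
        using calderon_norm_lin[OF lin, of "-1"] N G(3) by (simp add: distrib_right)
      show "?G \<in> calderon_ker S" by (rule calderon_ker_lin[OF F GS(1)])
    qed
  qed simp
qed

text \<open>Every representative of \<open>x\<close> in \<open>K\<close> also represents
  \<open>f x\<close> in \<open>K'\<close>, so the quotient norm does not increase and the constant 1
  serves.\<close>

lemma bounded_op_quotient:
  assumes K: "K \<subseteq> K'" "K' \<subseteq> calderon"
    and f: "\<And>F. F \<in> K \<Longrightarrow> f (T F) = T' F" "\<And>x y. f (x + y) = f x + f y" "\<And>c x. f (c *\<^sub>C x) = c *\<^sub>C f x"
  shows "bounded_op (quotient_space T K) (quotient_space T' K') f"
  unfolding bounded_op_def
proof (intro conjI ballI allI exI[of _ 1] f(2,3))
  show "f ` pts (quotient_space T K) \<subseteq> pts (quotient_space T' K')"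
    using K f(1) by (auto simp: quotient_space_def)
  fix x assume "x \<in> pts (quotient_space T K)"
  then have ne: "{F \<in> K. T F = x} \<noteq> {}" by (auto simp: quotient_space_def)
  have "nrm (quotient_space T' K') (f x) \<le> (INF F\<in>{F \<in> K. T F = x}. calderon_norm F)"
  proof (rule cINF_greatest[OF ne])
    fix F assume F: "F \<in> {F \<in> K. T F = x}"
    then have "f x = T' F" using f(1) by blast
    then show "nrm (quotient_space T' K') (f x) \<le> calderon_norm F"
      using quotient_nrm_le[OF K(2), of F T'] F K(1) by auto
  qed
  then show "nrm (quotient_space T' K') (f x) \<le> 1 * nrm (quotient_space T K) x"
    by (simp add: quotient_space_def)
qed

text \<open>The common form of the four sequences. Exactness comes from \<open>K\<close> being the
  kernel of \<open>T''\<close> on \<open>K'\<close>, and a projection would yield the excluded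
  \<open>diagonal_lift\<close>. Here \<open>R\<close> describes the middle space, \<open>S\<close>
  the kernel on which the section is tested, and \<rho> reads off the coefficient at
  \<open>r\<close>.\<close>

lemma nontrivial_quotient_sequence:
  fixes T :: "(complex \<Rightarrow> linf) \<Rightarrow> 'y::complex_normed_vector"
    and T' :: "(complex \<Rightarrow> linf) \<Rightarrow> 'z::complex_normed_vector"
    and T'' :: "(complex \<Rightarrow> linf) \<Rightarrow> 'x::complex_normed_vector"
  assumes K: "K' = calderon_ker R" "K = {F \<in> K'. T'' F = 0}"
    and i: "\<And>F. F \<in> K \<Longrightarrow> i (T F) = T' F" "\<And>x y. i (x + y) = i x + i y" "\<And>c x. i (c *\<^sub>C x) = c *\<^sub>C i x" "inj i"
    and q: "\<And>F. q (T' F) = T'' F" "\<And>x y. q (x + y) = q x + q y" "\<And>c x. q (c *\<^sub>C x) = c *\<^sub>C q x"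
    and RS: "R \<subseteq> S" and S: "\<And>c. c \<in> S \<Longrightarrow> c \<le> 2" "p \<notin> S" "p \<le> 2"
    and T'_lin: "\<And>F G c. F \<in> calderon \<Longrightarrow> G \<in> calderon \<Longrightarrow> T' (\<lambda>z. F z + c *\<^sub>C G z) = T' F + c *\<^sub>C T' G"
    and \<rho>: "\<And>u v c. \<rho> (u + c *\<^sub>C v) = \<rho> u + c *\<^sub>C \<rho> v" "\<And>F. \<rho> (T' F) = delta r F"
    and T'': "\<And>D. D \<in> calderon_ker R \<Longrightarrow> T'' D = 0 \<longleftrightarrow> D \<in> calderon_ker S \<and> delta p D = 0"
    and no_lift: "\<not> diagonal_lift S p r"
  shows "nontrivial_exact_sequence (quotient_space T K) i (quotient_space T' K') q (quotient_space T'' K')"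
  unfolding nontrivial_exact_sequence_def
proof
  have K': "K \<subseteq> K'" "K' \<subseteq> calderon" using K by (auto simp: calderon_ker_def)
  have image: "i ` pts (quotient_space T K) = {z \<in> pts (quotient_space T' K'). q z = 0}"
    using i(1) q(1) unfolding quotient_space_def K(2) by (auto simp: image_iff)
  show "exact_sequence (quotient_space T K) i (quotient_space T' K') q (quotient_space T'' K')"
    unfolding exact_sequence_def
  proof (intro conjI image)
    show "bounded_op (quotient_space T K) (quotient_space T' K') i"
      using K' i by (intro bounded_op_quotient) auto
    show "bounded_op (quotient_space T' K') (quotient_space T'' K') q"
      using K' q by (intro bounded_op_quotient) auto
    show "inj_on i (pts (quotient_space T K))"
      using i(4) by (rule inj_on_subset) simp
    show "q ` pts (quotient_space T' K') = pts (quotient_space T'' K')"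
      using q(1) by (auto simp: quotient_space_def image_iff)
  qed
  show "\<not> complemented (quotient_space T' K') (i ` pts (quotient_space T K))"
  proof
    assume "complemented (quotient_space T' K') (i ` pts (quotient_space T K))"
    then have "complemented (quotient_space T' (calderon_ker R)) {z \<in> T' ` calderon_ker R. q z = 0}"
      unfolding image by (simp add: quotient_space_def K(1))
    then have "diagonal_lift S p r"
    proof (rule diagonal_lift_if_complemented[OF _ RS T'_lin \<rho>])
      show "T' D \<in> {z \<in> T' ` calderon_ker R. q z = 0} \<longleftrightarrow> D \<in> calderon_ker S \<and> delta p D = 0"
        if "D \<in> calderon_ker R" for D
        using T''[OF that] that q(1) by auto
      show "\<exists>E\<in>calderon_ker S. delta p E = unit_seq j" for j
        by (rule exists_unit_jet[OF S(3,2,1)])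
    qed
    with no_lift show False ..
  qed
qed

section \<open>The four exact sequences\<close>

lemma kernel_pair_sequence:
  assumes abc: "b \<le> 2" "c \<le> 2" "b \<noteq> c" and no_lift: "\<not> diagonal_lift {c} b a"
  shows "nontrivial_exact_sequence
       (quotient_space (delta a) (ker_delta b \<inter> ker_delta c)) (\<lambda>x. (x, 0))
       (quotient_space (delta2 a b) (ker_delta c)) (\<lambda>(x, y). y)
       (quotient_space (delta b) (ker_delta c))"
  by (rule nontrivial_quotient_sequence[where R = "{c}" and S = "{c}" and p = b and r = a
        and \<rho> = fst, OF _ _ _ _ _ _ _ _ _ _ _ _ _ _ _ _ _ no_lift])
    (use abc in \<open>auto simp: calderon_ker_def ker_delta_def delta2_def delta3_def delta_lin
      scaleC_prod_def inj_on_def zero_prod_def\<close>)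

text \<open>The section over all pairs is tested only on functions with vanishing coefficient at
  \<open>c\<close>, hence \<open>R = {}\<close> but \<open>S = {c}\<close>; the obstruction is that
  of \<open>kernel_pair_sequence\<close>.\<close>

lemma triple_over_pair_sequence:
  assumes abc: "b \<le> 2" "c \<le> 2" "b \<noteq> c" and no_lift: "\<not> diagonal_lift {c} b a"
  shows "nontrivial_exact_sequence
       (quotient_space (delta a) (ker_delta b \<inter> ker_delta c)) (\<lambda>x. (x, 0, 0))
       (quotient_space (delta3 a b c) calderon) (\<lambda>(x, y, z). (y, z))
       (quotient_space (delta2 b c) calderon)"
  by (rule nontrivial_quotient_sequence[where R = "{}" and S = "{c}" and p = b and r = a
        and \<rho> = fst, OF _ _ _ _ _ _ _ _ _ _ _ _ _ _ _ _ _ no_lift])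
    (use abc in \<open>auto simp: calderon_ker_def ker_delta_def delta2_def delta3_def delta_lin
      scaleC_prod_def inj_on_def zero_prod_def\<close>)

text \<open>Reading off only the coefficient at \<open>b\<close> from the triple leaves the same
  obstruction as in \<open>pair_over_single_sequence\<close>.\<close>

lemma triple_over_single_sequence:
  assumes abc: "b \<le> 2" "c \<le> 2" and no_lift: "\<not> diagonal_lift {} c b"
  shows "nontrivial_exact_sequence
       (quotient_space (delta2 a b) (ker_delta c)) (\<lambda>(x, y). (x, y, 0))
       (quotient_space (delta3 a b c) calderon) (\<lambda>(x, y, z). z)
       (quotient_space (delta c) calderon)"
  by (rule nontrivial_quotient_sequence[where R = "{}" and S = "{}" and p = c and r = b
        and \<rho> = "\<lambda>u. fst (snd u)", OF _ _ _ _ _ _ _ _ _ _ _ _ _ _ _ _ _ no_lift])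
    (use abc in \<open>auto simp: calderon_ker_def ker_delta_def delta2_def delta3_def delta_lin
      scaleC_prod_def inj_on_def zero_prod_def\<close>)

lemma pair_over_single_sequence:
  assumes abc: "b \<le> 2" "c \<le> 2" and no_lift: "\<not> diagonal_lift {} c b"
  shows "nontrivial_exact_sequence
       (quotient_space (delta b) (ker_delta c)) (\<lambda>y. (y, 0))
       (quotient_space (delta2 b c) calderon) (\<lambda>(y, z). z)
       (quotient_space (delta c) calderon)"
  by (rule nontrivial_quotient_sequence[where R = "{}" and S = "{}" and p = c and r = b
        and \<rho> = fst, OF _ _ _ _ _ _ _ _ _ _ _ _ _ _ _ _ _ no_lift])
    (use abc in \<open>auto simp: calderon_ker_def ker_delta_def delta2_def delta3_def delta_lin
      scaleC_prod_def inj_on_def zero_prod_def\<close>)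

theorem corollary7p14:
  fixes a b c :: nat
  assumes "distinct [a, b, c]" and "{a, b, c} = {2, 1, 0}"
  shows
    "nontrivial_exact_sequence
       (quotient_space (delta a) (ker_delta b \<inter> ker_delta c)) (\<lambda>x. (x, 0))
       (quotient_space (delta2 a b) (ker_delta c)) (\<lambda>(x, y). y)
       (quotient_space (delta b) (ker_delta c))
   \<and> nontrivial_exact_sequence
       (quotient_space (delta a) (ker_delta b \<inter> ker_delta c)) (\<lambda>x. (x, 0, 0))
       (quotient_space (delta3 a b c) calderon) (\<lambda>(x, y, z). (y, z))
       (quotient_space (delta2 b c) calderon)
   \<and> nontrivial_exact_sequence
       (quotient_space (delta2 a b) (ker_delta c)) (\<lambda>(x, y). (x, y, 0))
       (quotient_space (delta3 a b c) calderon) (\<lambda>(x, y, z). z)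
       (quotient_space (delta c) calderon)
   \<and> nontrivial_exact_sequence
       (quotient_space (delta b) (ker_delta c)) (\<lambda>y. (y, 0))
       (quotient_space (delta2 b c) calderon) (\<lambda>(y, z). z)
       (quotient_space (delta c) calderon)"
proof -
  have "a \<in> {2, 1, 0}" "b \<in> {2, 1, 0}" "c \<in> {2, 1, 0}"
    using assms(2) by blast+
  then have abc: "b \<le> 2" "c \<le> 2" "b \<noteq> c" using assms(1) by auto
  note kernel = abc no_diagonal_lift_kernel[OF assms]
    and full = abc(1,2) no_diagonal_lift_full[OF abc(3,1,2)]
  show ?thesis
    by (intro conjI kernel_pair_sequence[OF kernel] triple_over_pair_sequence[OF kernel]
        triple_over_single_sequence[OF full] pair_over_single_sequence[OF full])
qed

end
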